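(* Fix an integer $r \geq 2$ and let $c$ be the unique positive real solution of $c = 1 - e^{-cr}$. There exists a function $g(n) = o(n)$ such that, as $n \to \infty$, with probability $1 - o(1)$ a random DFA with $n$ states over an alphabet of size $r$ has exactly one closed communicating class, this closed communicating class is aperiodic, and its size $M$ satisfies $|M - cn| \leq g(n)$.
   Context: A DFA is a tuple $A = \langle \Sigma, Q, q_0, \tau, \phi\rangle$ with finite alphabet $\Sigma$, finite state set $Q$, initial state $q_0 \in Q$, transition function $\tau : Q \times \Sigma \to Q$ and termination function $\phi : Q \to \{0,1\}$. Extend $\tau$ to strings in the usual way and write $\tau_\star(S) = \{\tau(q,x) : q \in S, x \in \Sigma^\star\}$ and $\tau_1(S) = \{\tau(q,\sigma) : q \in S, \sigma \in \Sigma\}$ for $S \subseteq Q$. Two states $q, q'$ communicate if each is reachable from the other by some string; this is an equivalence relation whose classes are the communicating classes. A communicating class $Q'$ is closed if $\tau_\star(Q') = Q'$. For $k > 1$, a closed communicating class $Q'$ is $k$-periodic if there is a partition of $Q'$ into $k$ nonempty parts $Q'_0, \ldots, Q'_{k-1}$ with $\tau_1(Q'_i) = Q'_{(i+1) \bmod k}$ for all $0 \leq i \leq k-1$; it is aperiodic if it is not $k$-periodic for any $k > 1$. A random DFA with $n$ states over an alphabet $\Sigma$ of size $r$ is obtained as follows: $Q = [n]$, the initial state is uniform in $Q$, each $\tau(q,\sigma)$ ($q \in Q$, $\sigma \in \Sigma$) is uniform in $Q$, each $\phi(q)$ is uniform in $\{0,1\}$, all choices mutually independent. *)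

theory Defs
  imports "HOL-Probability.Probability" "HOL-Library.Landau_Symbols"
begin

text \<open>A DFA with state set Q = {0..<n} and alphabet \<Sigma> = {0..<r} is represented by a
  triple (q0, tau, phi): initial state, transition function tau q a, termination
  function phi q \<in> {0,1}.\<close>

type_synonym dfa = "nat \<times> (nat \<Rightarrow> nat \<Rightarrow> nat) \<times> (nat \<Rightarrow> nat)"

definition dfa_space :: "nat \<Rightarrow> nat \<Rightarrow> dfa set" where
  "dfa_space n r =
     {0..<n} \<times> (PiE {0..<n} (\<lambda>_. PiE {0..<r} (\<lambda>_. {0..<n}))) \<times> (PiE {0..<n} (\<lambda>_. {0::nat, 1}))"

text \<open>Uniform distribution on all DFAs: equivalent to independent uniform choices of
  the initial state, of each tau(q,a), and of each phi(q).\<close>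
definition random_dfa :: "nat \<Rightarrow> nat \<Rightarrow> dfa pmf" where
  "random_dfa n r = pmf_of_set (dfa_space n r)"

definition trans :: "dfa \<Rightarrow> nat \<Rightarrow> nat \<Rightarrow> nat" where
  "trans A = fst (snd A)"

definition trans_star :: "dfa \<Rightarrow> nat \<Rightarrow> nat list \<Rightarrow> nat" where
  "trans_star A q w = foldl (trans A) q w"

definition tau_star :: "nat \<Rightarrow> dfa \<Rightarrow> nat set \<Rightarrow> nat set" where
  "tau_star r A S = {trans_star A q w | q w. q \<in> S \<and> w \<in> lists {0..<r}}"

definition tau_1 :: "nat \<Rightarrow> dfa \<Rightarrow> nat set \<Rightarrow> nat set" where
  "tau_1 r A S = {trans A q a | q a. q \<in> S \<and> a \<in> {0..<r}}"

definition reaches :: "nat \<Rightarrow> dfa \<Rightarrow> nat \<Rightarrow> nat \<Rightarrow> bool" where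
  "reaches r A q q' \<longleftrightarrow> (\<exists>w \<in> lists {0..<r}. trans_star A q w = q')"

definition communicate :: "nat \<Rightarrow> dfa \<Rightarrow> nat \<Rightarrow> nat \<Rightarrow> bool" where
  "communicate r A q q' \<longleftrightarrow> reaches r A q q' \<and> reaches r A q' q"

definition comm_class :: "nat \<Rightarrow> nat \<Rightarrow> dfa \<Rightarrow> nat set \<Rightarrow> bool" where
  "comm_class n r A C \<longleftrightarrow> (\<exists>q \<in> {0..<n}. C = {q' \<in> {0..<n}. communicate r A q q'})"

definition closed_class :: "nat \<Rightarrow> nat \<Rightarrow> dfa \<Rightarrow> nat set \<Rightarrow> bool" where
  "closed_class n r A C \<longleftrightarrow> comm_class n r A C \<and> tau_star r A C = C"

definition periodic :: "nat \<Rightarrow> dfa \<Rightarrow> nat \<Rightarrow> nat set \<Rightarrow> bool" where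
  "periodic r A k C \<longleftrightarrow> k > 1 \<and>
     (\<exists>P :: nat \<Rightarrow> nat set.
        (\<forall>i<k. P i \<noteq> {}) \<and>
        (\<Union>i<k. P i) = C \<and>
        (\<forall>i<k. \<forall>j<k. i \<noteq> j \<longrightarrow> P i \<inter> P j = {}) \<and>
        (\<forall>i<k. tau_1 r A (P i) = P ((i + 1) mod k)))"

definition aperiodic :: "nat \<Rightarrow> dfa \<Rightarrow> nat set \<Rightarrow> bool" where
  "aperiodic r A C \<longleftrightarrow> \<not> (\<exists>k>1. periodic r A k C)"

end

theory Submission
  imports Defs "HOL-Real_Asymp.Real_Asymp"
begin

text \<open>
  First moment method. Call \<open>C\<close> with \<open>card C = a\<close> self-covering if
  \<open>tau_1 C = C\<close>; closed communicating classes are self-covering. Bounding the number of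
  surjections by \<open>m! (exp z - 1) ^ a / z ^ m\<close> (coefficients of \<open>(exp z - 1) ^ a\<close>) with
  \<open>m = r a\<close> and \<open>z = r a / n\<close>, the expected number of self-covering sets of size \<open>a\<close>
  is at most \<open>O(n)\<close> times the probability that a binomial variable with parameters \<open>n\<close>
  and \<open>1 - exp (- r a / n)\<close> equals \<open>a\<close>. By Hoeffding this is tiny unless
  \<open>a / n\<close> almost solves \<open>x = 1 - exp (- r x)\<close>, i.e. unless \<open>a\<close> is close to
  \<open>c n\<close> or to \<open>0\<close>; a cruder count excludes \<open>a \<le> n / 6\<close>. Since \<open>c > 1 / 2\<close>
  and distinct classes are disjoint, the closed class is unique.

  Prescribing in addition a cyclic partition with parts of sizes \<open>a\<^sub>i\<close> replaces \<open>(r a)!\<close>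
  by the product of the \<open>(r a\<^sub>i)!\<close>. For \<open>r \<ge> 2\<close> this gain beats the number of
  partitions, and exponentially so because a periodic class can be cut into two consecutive
  blocks of parts of comparable sizes.
\<close>

subsection \<open>Surjections and ordered partitions\<close>

lemma sum_card_Pow:
  assumes "finite S"
  shows "(\<Sum>U\<in>Pow S. f (card U)) = (\<Sum>j\<le>card S. of_nat (card S choose j) * (f j :: real))"
proof -
  have "(\<Sum>U\<in>Pow S. f (card U)) = (\<Sum>j\<in>{..card S}. \<Sum>U | U \<in> Pow S \<and> card U = j. f (card U))"
    using assms by (intro sum.group[symmetric]) (auto intro: card_mono)
  also have "\<dots> = (\<Sum>j\<in>{..card S}. of_nat (card S choose j) * f j)"
    by (intro sum.cong refl) (simp add: n_subsets[OF assms])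
  finally show ?thesis .
qed

text \<open>Grouping by \<open>j = card U\<close> turns the sum into \<open>fact (card S)\<close>
  times a partial sum of the exponential series, because
  \<open>(m choose j) * fact (m - j) = fact m / fact j\<close>. Omitting \<open>U = {}\<close>
  removes the constant term.\<close>

lemma sum_fact_pow_le_exp:
  fixes z :: real
  assumes "finite S" "z > 0"
  shows "(\<Sum>U\<in>Pow S - {{}}. fact (card S - card U) * z ^ card U) \<le> fact (card S) * (exp z - 1)"
proof -
  let ?m = "card S"
  have "(\<Sum>U\<in>Pow S. fact (?m - card U) * z ^ card U) =
        (\<Sum>j\<le>?m. of_nat (?m choose j) * (fact (?m - j) * z ^ j))"
    by (rule sum_card_Pow[OF assms(1)])
  also have "\<dots> = fact ?m * (\<Sum>j\<le>?m. z ^ j / fact j)"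
    unfolding sum_distrib_left
    by (intro sum.cong refl) (simp add: binomial_fact field_simps)
  also have "(\<Sum>j\<le>?m. z ^ j / fact j) \<le> exp z"
  proof -
    have "(\<Sum>j\<in>{..?m}. z ^ j /\<^sub>R fact j) \<le> exp z"
      unfolding exp_def using assms(2) summable_exp_generic[of z]
      by (intro sum_le_suminf) auto
    then show ?thesis by (simp add: divide_inverse mult.commute)
  qed
  finally have "(\<Sum>U\<in>Pow S. fact (?m - card U) * z ^ card U) \<le> fact ?m * exp z"
    by (simp add: mult_left_mono)
  moreover have "(\<Sum>U\<in>Pow S - {{}}. fact (?m - card U) * z ^ card U) =
     (\<Sum>U\<in>Pow S. fact (?m - card U) * z ^ card U) - fact ?m"
    using assms(1) by (subst sum_diff1) auto
  ultimately show ?thesis by (simp add: algebra_simps)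
qed

text \<open>Induction on \<open>B\<close>. Removing a point \<open>y\<close> also removes its fibre,
  a nonempty set of points of the colour \<open>\<mu> y\<close>; by
  \<open>sum_fact_pow_le_exp\<close>, summing over the possible fibres restores the factorial of
  that colour class and contributes one factor \<open>exp z - 1\<close>. With a single colour this
  is the coefficient bound for surjections; several colours serve for cyclic partitions.\<close>

lemma card_colored_surj_le:
  fixes z :: real and \<kappa> :: "'a \<Rightarrow> 'c" and \<mu> :: "'b \<Rightarrow> 'c"
  assumes "finite B" "finite X" "finite I" "z > 0" "\<kappa> ` X \<subseteq> I"
  shows "real (card {f \<in> X \<rightarrow>\<^sub>E B. f ` X = B \<and> (\<forall>x\<in>X. \<mu> (f x) = \<kappa> x)})
    \<le> (\<Prod>i\<in>I. fact (card {x\<in>X. \<kappa> x = i})) * (exp z - 1) ^ card B / z ^ card X"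
  using assms(1,2,5)
proof (induction B arbitrary: X rule: finite_induct)
  case empty
  show ?case
  proof (cases "X = {}")
    case False
    then have none: "{f \<in> X \<rightarrow>\<^sub>E {}. f ` X = {} \<and> (\<forall>x\<in>X. \<mu> (f x) = \<kappa> x)} = {}" by auto
    show ?thesis unfolding none using assms(4) by (simp add: prod_nonneg)
  qed (simp add: Collect_conv_if)
next
  case (insert y B)
  define N where "N Y D = {f \<in> Y \<rightarrow>\<^sub>E D. f ` Y = D \<and> (\<forall>x\<in>Y. \<mu> (f x) = \<kappa> x)}" for Y D
  define c where "c = \<mu> y"
  define S where "S = {x\<in>X. \<kappa> x = c}"
  let ?E = "exp z - 1 :: real"
  have E0: "?E > 0" using assms(4) by simp
  have finS: "finite S" using insert by (simp add: S_def)
  have finN: "finite (N (X - U) B)" for U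
    unfolding N_def using insert by (intro finite_subset[OF _ finite_PiE[of "X - U" "\<lambda>_. B"]]) auto
  \<comment> \<open>A map is determined by its fibre over \<open>y\<close> together with its
    restriction to the complement of that fibre.\<close>
  have "card (N X (insert y B)) \<le> card (SIGMA U : Pow S - {{}}. N (X - U) B)"
  proof (rule card_inj_on_le[where f = "\<lambda>f. ({x\<in>X. f x = y}, restrict f (X - {x\<in>X. f x = y}))"])
    show "inj_on (\<lambda>f. ({x\<in>X. f x = y}, restrict f (X - {x\<in>X. f x = y}))) (N X (insert y B))"
    proof (rule inj_onI)
      fix f g
      assume f: "f \<in> N X (insert y B)" and g: "g \<in> N X (insert y B)"
        and eq: "({x\<in>X. f x = y}, restrict f (X - {x\<in>X. f x = y})) =
                 ({x\<in>X. g x = y}, restrict g (X - {x\<in>X. g x = y}))"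
      have U: "{x\<in>X. f x = y} = {x\<in>X. g x = y}" using eq by simp
      show "f = g"
      proof (rule PiE_ext[of f X "\<lambda>_. insert y B"])
        fix x assume x: "x \<in> X"
        have "restrict f (X - {x\<in>X. f x = y}) = restrict g (X - {x\<in>X. g x = y})"
          by (rule conjunct2[OF eq[unfolded prod.inject]])
        then have "restrict f (X - {x\<in>X. f x = y}) x = restrict g (X - {x\<in>X. g x = y}) x"
          by (rule fun_cong)
        moreover have "f x = y \<longleftrightarrow> g x = y" using U x by blast
        ultimately show "f x = g x" using x by (cases "f x = y") (auto simp: U)
      qed (use f g in \<open>auto simp: N_def\<close>)
    qed
    show "(\<lambda>f. ({x\<in>X. f x = y}, restrict f (X - {x\<in>X. f x = y}))) ` N X (insert y B)
        \<subseteq> (SIGMA U : Pow S - {{}}. N (X - U) B)"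
    proof (rule image_subsetI)
      fix f assume f: "f \<in> N X (insert y B)"
      let ?U = "{x\<in>X. f x = y}"
      have im: "f ` X = insert y B" and fc: "\<forall>x\<in>X. \<mu> (f x) = \<kappa> x" using f by (auto simp: N_def)
      have "?U \<subseteq> S" using fc by (auto simp: S_def c_def)
      moreover have "?U \<noteq> {}" using im by (auto simp: image_iff) (metis imageE insertI1)
      moreover have "restrict f (X - ?U) \<in> N (X - ?U) B"
      proof -
        have "f ` (X - ?U) = f ` X - {y}" by blast
        then have "f ` (X - ?U) = B" using im \<open>y \<notin> B\<close> by simp
        then show ?thesis unfolding N_def using fc by (auto simp: image_restrict_eq)
      qed
      ultimately show "({x\<in>X. f x = y}, restrict f (X - {x\<in>X. f x = y})) \<in> (SIGMA U : Pow S - {{}}. N (X - U) B)"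
        by auto
    qed
    show "finite (SIGMA U : Pow S - {{}}. N (X - U) B)"
      using finS finN by auto
  qed
  also have "\<dots> = (\<Sum>U\<in>Pow S - {{}}. card (N (X - U) B))"
    using finS finN by (subst card_SigmaI) auto
  finally have "real (card (N X (insert y B))) \<le> (\<Sum>U\<in>Pow S - {{}}. real (card (N (X - U) B)))"
    by (metis of_nat_mono of_nat_sum)
  also have "\<dots> \<le> (\<Sum>U\<in>Pow S - {{}}. (\<Prod>i\<in>I - {c}. fact (card {x\<in>X. \<kappa> x = i})) *
       ?E ^ card B / z ^ card X * (fact (card S - card U) * z ^ card U))"
  proof (rule sum_mono)
    fix U assume U: "U \<in> Pow S - {{}}"
    then have UX: "U \<subseteq> X" and US: "U \<subseteq> S" and "U \<noteq> {}" by (auto simp: S_def)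
    have cI: "c \<in> I" using U insert.prems by (auto simp: S_def)
    have "real (card (N (X - U) B)) \<le>
        (\<Prod>i\<in>I. fact (card {x\<in>X - U. \<kappa> x = i})) * ?E ^ card B / z ^ card (X - U)"
      unfolding N_def using insert.prems by (intro insert.IH) auto
    also have "(\<Prod>i\<in>I. fact (card {x\<in>X - U. \<kappa> x = i})) =
        fact (card {x\<in>X - U. \<kappa> x = c}) * (\<Prod>i\<in>I - {c}. fact (card {x\<in>X - U. \<kappa> x = i}) :: real)"
      using cI assms(3) by (simp add: prod.remove)
    also have "{x\<in>X - U. \<kappa> x = c} = S - U" by (auto simp: S_def)
    also have "(\<Prod>i\<in>I - {c}. fact (card {x\<in>X - U. \<kappa> x = i}) :: real) =
        (\<Prod>i\<in>I - {c}. fact (card {x\<in>X. \<kappa> x = i}))"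
    proof (rule prod.cong)
      fix i assume "i \<in> I - {c}"
      then have "{x\<in>X - U. \<kappa> x = i} = {x\<in>X. \<kappa> x = i}" using US by (auto simp: S_def)
      then show "(fact (card {x\<in>X - U. \<kappa> x = i}) :: real) = fact (card {x\<in>X. \<kappa> x = i})" by simp
    qed simp
    also have "card (S - U) = card S - card U"
      using US finS by (simp add: card_Diff_subset finite_subset)
    also have "z ^ card (X - U) = z ^ card X / z ^ card U"
    proof -
      have "card (X - U) = card X - card U" "card U \<le> card X"
        using UX insert.prems by (auto simp: card_Diff_subset finite_subset card_mono)
      then show ?thesis using assms(4) by (simp add: power_diff)
    qed
    finally show "real (card (N (X - U) B)) \<le> (\<Prod>i\<in>I - {c}. fact (card {x\<in>X. \<kappa> x = i})) *
       ?E ^ card B / z ^ card X * (fact (card S - card U) * z ^ card U)"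
      by (simp add: field_simps)
  qed
  also have "\<dots> = (\<Prod>i\<in>I - {c}. fact (card {x\<in>X. \<kappa> x = i})) *
       ?E ^ card B / z ^ card X * (\<Sum>U\<in>Pow S - {{}}. fact (card S - card U) * z ^ card U)"
    by (simp add: sum_distrib_left)
  also have "\<dots> \<le> (\<Prod>i\<in>I. fact (card {x\<in>X. \<kappa> x = i})) * ?E ^ card (insert y B) / z ^ card X"
  \<comment> \<open>If no point has the colour of \<open>y\<close>, no fibre is admissible and the
    sum is empty; only otherwise is \<open>c\<close> known to lie in \<open>I\<close>, so that its
    factor can be split off the product.\<close>
  proof (cases "S = {}")
    case True
    then show ?thesis using E0 assms(4) by (simp add: prod_nonneg)
  next
    case False
    then have cI: "c \<in> I" using insert.prems by (auto simp: S_def)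
    have "(\<Prod>i\<in>I - {c}. fact (card {x\<in>X. \<kappa> x = i})) *
       ?E ^ card B / z ^ card X * (\<Sum>U\<in>Pow S - {{}}. fact (card S - card U) * z ^ card U)
       \<le> (\<Prod>i\<in>I - {c}. fact (card {x\<in>X. \<kappa> x = i})) * ?E ^ card B / z ^ card X * (fact (card S) * ?E)"
      using E0 assms(4) sum_fact_pow_le_exp[OF finS assms(4)]
      by (intro mult_left_mono) (auto intro!: divide_nonneg_pos mult_nonneg_nonneg prod_nonneg)
    also have "\<dots> = (fact (card S) * (\<Prod>i\<in>I - {c}. fact (card {x\<in>X. \<kappa> x = i}))) * ?E ^ card (insert y B) / z ^ card X"
      using insert.hyps by simp
    also have "fact (card S) * (\<Prod>i\<in>I - {c}. fact (card {x\<in>X. \<kappa> x = i})) =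
        (\<Prod>i\<in>I. fact (card {x\<in>X. \<kappa> x = i}) :: real)"
      using cI assms(3) by (subst (2) prod.remove) (auto simp: S_def)
    finally show ?thesis .
  qed
  finally show ?case unfolding N_def .
qed

section \<open>Binomial inequalities and the total weight of ordered partitions\<close>

lemma choose_mult_le:
  "(m choose j) * (n choose i) \<le> ((m + n) choose (j + i))"
proof -
  have "(m choose j) * (n choose (j + i - j)) \<le> (\<Sum>k\<le>j + i. (m choose k) * (n choose (j + i - k)))"
    by (rule member_le_sum) auto
  then show ?thesis by (simp add: vandermonde)
qed

text \<open>Choosing a \<open>j\<close>-subset in each of \<open>r\<close> disjoint copies of an
  \<open>s\<close>-set yields an \<open>r * j\<close>-subset of their union; formally, one term of
  Vandermonde's identity is used per copy.\<close>

lemma choose_power_le: "(s choose j) ^ r \<le> ((r * s) choose (r * j))"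
proof (induction r)
  case (Suc r)
  have "(s choose j) ^ Suc r \<le> (s choose j) * ((r * s) choose (r * j))"
    using Suc by simp
  also have "\<dots> \<le> ((s + r * s) choose (j + r * j))" by (rule choose_mult_le)
  finally show ?case by simp
qed simp

text \<open>For \<open>r \<ge> 2\<close>, splitting \<open>s\<close> into two blocks costs more than the choice of the blocks gains.\<close>
lemma choose_fact_mult_le:
  assumes "r \<ge> 2" "j \<le> s"
  shows "real (s choose j) * fact (r * j) * fact (r * (s - j)) \<le> fact (r * s) / real (s choose j)"
proof -
  have pos: "real (s choose j) > 0" using assms by simp
  have "(s choose j) ^ 2 \<le> (s choose j) ^ r"
    using assms by (intro power_increasing) (auto simp: Suc_le_eq)
  also have "\<dots> \<le> ((r * s) choose (r * j))" by (rule choose_power_le)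
  finally have "real (s choose j) ^ 2 \<le> real ((r * s) choose (r * j))"
    by (metis of_nat_le_iff of_nat_power)
  also have "\<dots> = fact (r * s) / (fact (r * j) * fact (r * (s - j)))"
    using assms by (simp add: binomial_fact diff_mult_distrib2)
  finally show ?thesis using pos by (simp add: field_simps power2_eq_square)
qed

text \<open>Lists are used because \<open>cyclic\<close> refers to the position of a block and
  because recursion can split off the first block. The number of blocks is left open, so that all
  periods are treated at once.\<close>

definition ordered_partitions :: "'a set \<Rightarrow> 'a set list set" where
  "ordered_partitions S = {Ps. {} \<notin> set Ps \<and> sorted_wrt disjnt Ps \<and> \<Union>(set Ps) = S}"

lemma ordered_partitions_empty [simp]: "ordered_partitions {} = {[]}"
  by (auto simp: ordered_partitions_def) (metis list.set_intros(1) neq_Nil_conv)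

lemma ordered_partitions_rec:
  assumes "S \<noteq> {}"
  shows "ordered_partitions S = (\<Union>P\<in>Pow S - {{}}. (#) P ` ordered_partitions (S - P))"
proof (intro set_eqI iffI)
  fix Ps assume Ps: "Ps \<in> ordered_partitions S"
  then obtain P Qs where [simp]: "Ps = P # Qs"
    using assms by (cases Ps) (auto simp: ordered_partitions_def)
  have "P \<in> Pow S - {{}}" "Qs \<in> ordered_partitions (S - P)"
    using Ps by (auto simp: ordered_partitions_def disjnt_def)
  then show "Ps \<in> (\<Union>P\<in>Pow S - {{}}. (#) P ` ordered_partitions (S - P))" by auto
next
  fix Ps assume "Ps \<in> (\<Union>P\<in>Pow S - {{}}. (#) P ` ordered_partitions (S - P))"
  then obtain P Qs where "P \<subseteq> S" "P \<noteq> {}" "Ps = P # Qs" "Qs \<in> ordered_partitions (S - P)" by auto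
  then show "Ps \<in> ordered_partitions S"
    by (auto simp: ordered_partitions_def disjnt_def)
qed

lemma finite_ordered_partitions: "finite S \<Longrightarrow> finite (ordered_partitions S)"
proof (induction S rule: finite_psubset_induct)
  case (psubset S)
  show ?case
  proof (cases "S = {}")
    case False
    show ?thesis unfolding ordered_partitions_rec[OF False]
      using psubset by (intro finite_UN_I finite_imageI psubset.IH) auto
  qed simp
qed

text \<open>Split off the first block, of size \<open>j\<close>, and apply induction to the rest.
  For \<open>0 < j < s\<close>, \<open>choose_fact_mult_le\<close> bounds the contribution by
  \<open>fact (r * s) * (s - j) / (s choose j)\<close>, which is at most
  \<open>fact (r * s)\<close>; the single block \<open>j = s\<close> adds one more such term,
  \<open>s\<close> in total. The \<open>max 1\<close> accounts for the empty set, whose only ordered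
  partition is \<open>[]\<close> with weight 1.\<close>

lemma sum_ordered_partitions_le:
  assumes "r \<ge> 2" "finite S"
  shows "(\<Sum>Ps\<in>ordered_partitions S. \<Prod>P\<leftarrow>Ps. fact (r * card P))
    \<le> real (max 1 (card S)) * fact (r * card S)"
  using assms(2)
proof (induction S rule: finite_psubset_induct)
  case (psubset S)
  define L where "L T = (\<Sum>Ps\<in>ordered_partitions T. \<Prod>P\<leftarrow>Ps. fact (r * card P) :: real)" for T :: "'a set"
  define s where "s = card S"
  show ?case
  proof (cases "S = {}")
    case False
    then have s0: "s > 0" using psubset by (auto simp: s_def)
    define F where "F j = (if j = 0 then 0 else fact (r * j) * (real (max 1 (s - j)) * fact (r * (s - j))))" for j
    have "L S = (\<Sum>P\<in>Pow S - {{}}. \<Sum>Ps\<in>(#) P ` ordered_partitions (S - P). \<Prod>P\<leftarrow>Ps. fact (r * card P))"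
      unfolding L_def ordered_partitions_rec[OF False]
      using psubset by (intro sum.UNION_disjoint) (auto intro!: finite_imageI finite_ordered_partitions)
    also have "\<dots> = (\<Sum>P\<in>Pow S - {{}}. fact (r * card P) * L (S - P))"
      by (subst sum.reindex) (auto simp: L_def sum_distrib_left)
    also have "\<dots> \<le> (\<Sum>P\<in>Pow S - {{}}. F (card P))"
    proof (rule sum_mono)
      fix P assume P: "P \<in> Pow S - {{}}"
      then have "finite P" using psubset by (auto intro: finite_subset)
      then have c: "card (S - P) = s - card P" "card P \<noteq> 0"
        using P by (auto simp: card_Diff_subset s_def)
      have "L (S - P) \<le> real (max 1 (card (S - P))) * fact (r * card (S - P))"
        unfolding L_def using P by (intro psubset.IH) auto
      then show "fact (r * card P) * L (S - P) \<le> F (card P)"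
        using c by (simp add: F_def)
    qed
    also have "\<dots> \<le> (\<Sum>P\<in>Pow S. F (card P))"
      using psubset by (intro sum_mono2) (auto simp: F_def)
    also have "\<dots> = (\<Sum>j\<le>s. real (s choose j) * F j)"
      unfolding s_def by (rule sum_card_Pow) fact
    also have "\<dots> = (\<Sum>j\<in>{1..<s}. real (s choose j) * F j) + fact (r * s)"
    proof -
      have "{..s} = insert 0 (insert s {1..<s})" using s0 by auto
      then show ?thesis using s0 by (simp add: F_def)
    qed
    also have "(\<Sum>j\<in>{1..<s}. real (s choose j) * F j) \<le> (\<Sum>j\<in>{1..<s}. fact (r * s))"
    proof (rule sum_mono)
      fix j assume j: "j \<in> {1..<s}"
      have "max 1 (s - j) = s - j" using j by auto
      then have "real (s choose j) * F j = real (s - j) * (real (s choose j) * fact (r * j) * fact (r * (s - j)))"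
        using j by (simp add: F_def)
      also have "\<dots> \<le> real (s - j) * (fact (r * s) / real (s choose j))"
        using j by (intro mult_left_mono choose_fact_mult_le assms) auto
      also have "\<dots> = fact (r * s) * (real (s - j) / real (s choose j))" by simp
      \<comment> \<open>Binomial coefficients away from both ends of the row are at least
        \<open>s choose 1 = s\<close>.\<close>
      also have "real (s - j) / real (s choose j) \<le> 1"
      proof -
        have "s choose 1 \<le> (s choose j)"
        proof (cases "2 * j \<le> s")
          case True then show ?thesis using j by (intro binomial_mono) auto
        next
          case False
          have "s choose 1 \<le> (s choose (s - j))" using j False by (intro binomial_mono) auto
          also have "\<dots> = (s choose j)" using j by (intro binomial_symmetric[symmetric]) auto
          finally show ?thesis .
        qed
        then show ?thesis using j by simp
      qed
      then have "fact (r * s) * (real (s - j) / real (s choose j)) \<le> fact (r * s) * 1"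
        by (rule mult_left_mono) simp
      finally show "real (s choose j) * F j \<le> fact (r * s)" by simp
    qed
    finally have "L S \<le> (\<Sum>j\<in>{1..<s}. fact (r * s)) + fact (r * s)" by simp
    also have "\<dots> = real (max 1 s) * fact (r * s)"
      using s0 by (simp add: algebra_simps of_nat_diff max_def)
    finally show ?thesis by (simp add: L_def s_def)
  qed simp
qed

subsection \<open>Probabilities in the random DFA\<close>

lemma prob_bex_le:
  assumes "finite I"
  shows "measure_pmf.prob p {A. \<exists>i\<in>I. Q i A} \<le> (\<Sum>i\<in>I. measure_pmf.prob p {A. Q i A})"
proof -
  have "{A. \<exists>i\<in>I. Q i A} = (\<Union>i\<in>I. {A. Q i A})" by auto
  then show ?thesis
    using measure_pmf.finite_measure_subadditive_finite[OF assms, of "\<lambda>i. {A. Q i A}" p] by simp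
qed

lemma finite_dfa_space: "finite (dfa_space n r)"
  unfolding dfa_space_def by (intro finite_cartesian_product finite_PiE) auto

lemma card_dfa_space: "card (dfa_space n r) = n * ((n ^ r) ^ n * 2 ^ n)"
  by (simp add: dfa_space_def card_cartesian_product card_PiE numeral_2_eq_2)

lemma dfa_space_nonempty: "n > 0 \<Longrightarrow> dfa_space n r \<noteq> {}"
  using card_dfa_space[of n r] by force

text \<open>The table of all transitions leaving \<open>C\<close>, as an extensional function on
  state-letter pairs. Events that depend only on these transitions become membership of the table in
  a finite set, and their probability is bounded by counting.\<close>

definition restrict_trans :: "nat \<Rightarrow> nat set \<Rightarrow> dfa \<Rightarrow> nat \<times> nat \<Rightarrow> nat" where
  "restrict_trans r C A = (\<lambda>x\<in>C \<times> {0..<r}. trans A (fst x) (snd x))"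

text \<open>Prescribing the \<open>r * card C\<close> entries divides the number of automata by
  \<open>n\<close> for each entry. This is an inequality because \<open>f\<close> may be
  unattainable, for instance by taking values outside \<open>{0..<n}\<close>.\<close>

lemma prob_restrict_trans_eq_le:
  assumes "n > 0" "C \<subseteq> {0..<n}"
  shows "measure_pmf.prob (random_dfa n r) {A. restrict_trans r C A = f} \<le> 1 / real n ^ (r * card C)"
proof -
  let ?S = "{0..<n} \<times> (PiE {0..<n} (\<lambda>q. PiE {0..<r} (\<lambda>a. if q \<in> C then {f (q, a)} else {0..<n}))) \<times>
     (PiE {0..<n} (\<lambda>_. {0::nat, 1}))"
  have finC: "finite C" and cC: "card C \<le> n"
    using assms(2) by (auto intro: finite_subset simp: subset_eq_atLeast0_lessThan_card)
  have "dfa_space n r \<inter> {A. restrict_trans r C A = f} \<subseteq> ?S"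
  proof
    fix A assume "A \<in> dfa_space n r \<inter> {A. restrict_trans r C A = f}"
    then obtain q0 t ph where A: "A = (q0, t, ph)" "q0 \<in> {0..<n}"
      "t \<in> PiE {0..<n} (\<lambda>_. PiE {0..<r} (\<lambda>_. {0..<n}))" "ph \<in> PiE {0..<n} (\<lambda>_. {0::nat, 1})"
      "restrict_trans r C A = f"
      by (auto simp: dfa_space_def)
    have tf: "t q a = f (q, a)" if "q \<in> C" "a < r" for q a
      using that fun_cong[OF A(5), of "(q, a)"] A(1) by (simp add: restrict_trans_def trans_def)
    have "t q \<in> PiE {0..<r} (\<lambda>a. if q \<in> C then {f (q, a)} else {0..<n})" if "q \<in> {0..<n}" for q
      using PiE_mem[OF A(3) that] tf by (auto simp: PiE_iff)
    then have "t \<in> PiE {0..<n} (\<lambda>q. PiE {0..<r} (\<lambda>a. if q \<in> C then {f (q, a)} else {0..<n}))"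
      using A(3) by (simp add: PiE_iff)
    then show "A \<in> ?S" using A by simp
  qed
  moreover have "finite ?S" by (intro finite_cartesian_product finite_PiE) auto
  ultimately have "card (dfa_space n r \<inter> {A. restrict_trans r C A = f}) \<le> card ?S"
    by (rule card_mono[rotated])
  also have "card ?S = n * ((\<Prod>q\<in>{0..<n}. \<Prod>a\<in>{0..<r}. if q \<in> C then 1 else n) * 2 ^ n)"
    by (simp add: card_cartesian_product card_PiE if_distrib numeral_2_eq_2 cong: if_cong)
  also have "(\<Prod>q\<in>{0..<n}. \<Prod>a\<in>{0..<r}. if q \<in> C then 1 else n) = (\<Prod>q\<in>{0..<n}. if q \<in> C then 1 else n ^ r)"
    by (intro prod.cong) auto
  also have "\<dots> = (\<Prod>q\<in>{0..<n} - C. n ^ r)"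
    by (intro prod.mono_neutral_cong_right) auto
  also have "\<dots> = (n ^ r) ^ (n - card C)"
    using assms(2) finC by (simp add: card_Diff_subset)
  finally have "real (card (dfa_space n r \<inter> {A. restrict_trans r C A = f})) \<le>
      real (n * ((n ^ r) ^ (n - card C) * 2 ^ n))"
    by (simp only: of_nat_le_iff)
  also have "\<dots> = real n * (real n ^ (r * n) / real n ^ (r * card C) * 2 ^ n)"
  proof -
    have "real ((n ^ r) ^ (n - card C)) = real n ^ (r * n - r * card C)"
      by (simp add: power_mult[symmetric] diff_mult_distrib2)
    also have "\<dots> = real n ^ (r * n) / real n ^ (r * card C)"
      using cC assms(1) by (intro power_diff) auto
    finally show ?thesis by (simp only: of_nat_mult of_nat_power of_nat_numeral)
  qed
  finally have "real (card (dfa_space n r \<inter> {A. restrict_trans r C A = f})) / real (card (dfa_space n r)) \<le>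
      real n * (real n ^ (r * n) / real n ^ (r * card C) * 2 ^ n) / real (card (dfa_space n r))"
    by (rule divide_right_mono) simp
  also have "\<dots> = 1 / real n ^ (r * card C)"
    using assms(1) by (simp add: card_dfa_space power_mult[symmetric])
  finally show ?thesis
    unfolding random_dfa_def
    by (subst measure_pmf_of_set[OF dfa_space_nonempty[OF assms(1)] finite_dfa_space])
qed

lemma prob_restrict_trans_le:
  assumes "n > 0" "C \<subseteq> {0..<n}" "finite F"
  shows "measure_pmf.prob (random_dfa n r) {A. restrict_trans r C A \<in> F} \<le> real (card F) / real n ^ (r * card C)"
proof -
  have "measure_pmf.prob (random_dfa n r) {A. restrict_trans r C A \<in> F} =
      measure_pmf.prob (random_dfa n r) {A. \<exists>f\<in>F. restrict_trans r C A = f}" by simp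
  also have "\<dots> \<le> (\<Sum>f\<in>F. measure_pmf.prob (random_dfa n r) {A. restrict_trans r C A = f})"
    by (rule prob_bex_le) fact
  also have "\<dots> \<le> (\<Sum>f\<in>F. 1 / real n ^ (r * card C))"
    by (intro sum_mono prob_restrict_trans_eq_le assms)
  finally show ?thesis by simp
qed

lemma prob_closed_le:
  assumes "n > 0" "C \<subseteq> {0..<n}"
  shows "measure_pmf.prob (random_dfa n r) {A. tau_1 r A C \<subseteq> C} \<le> (real (card C) / real n) ^ (r * card C)"
proof -
  have finC: "finite C" using assms(2) by (auto intro: finite_subset)
  have "{A. tau_1 r A C \<subseteq> C} \<subseteq> {A. restrict_trans r C A \<in> (C \<times> {0..<r}) \<rightarrow>\<^sub>E C}"
    by (force simp: tau_1_def restrict_trans_def)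
  then have "measure_pmf.prob (random_dfa n r) {A. tau_1 r A C \<subseteq> C} \<le>
      measure_pmf.prob (random_dfa n r) {A. restrict_trans r C A \<in> (C \<times> {0..<r}) \<rightarrow>\<^sub>E C}"
    by (intro measure_pmf.finite_measure_mono) auto
  also have "\<dots> \<le> real (card ((C \<times> {0..<r}) \<rightarrow>\<^sub>E C)) / real n ^ (r * card C)"
    using finC by (intro prob_restrict_trans_le assms finite_PiE) auto
  also have "\<dots> = (real (card C) / real n) ^ (r * card C)"
    using finC by (simp add: card_PiE card_cartesian_product power_divide mult.commute)
  finally show ?thesis .
qed

text \<open>Surjectivity on the union and inclusion of consecutive images are exactly what the
  coloured count exploits. For a one-block list \<open>[C]\<close> this is just
  \<open>tau_1 r A C = C\<close>, so that one estimate covers both self-covering sets and cyclic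
  partitions.\<close>

definition cyclic :: "nat \<Rightarrow> dfa \<Rightarrow> nat set list \<Rightarrow> bool" where
  "cyclic r A Ps \<longleftrightarrow> tau_1 r A (\<Union>(set Ps)) = \<Union>(set Ps) \<and>
     (\<forall>i<length Ps. tau_1 r A (Ps ! i) \<subseteq> Ps ! ((i + 1) mod length Ps))"

text \<open>Colour a pair \<open>(q, a)\<close> by the index of the block of \<open>q\<close>, and a
  target state by the index of the block before its own. The table on \<open>C\<close> is then a
  colour-preserving surjection onto \<open>C\<close>, and the colour class of index \<open>i\<close>
  has \<open>r * card (Ps ! i)\<close> elements, so \<open>card_colored_surj_le\<close>
  applies.\<close>

lemma prob_cyclic_le:
  assumes "n > 0" "C \<subseteq> {0..<n}" "Ps \<in> ordered_partitions C" "z > 0"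
  shows "measure_pmf.prob (random_dfa n r) {A. cyclic r A Ps}
    \<le> (\<Prod>P\<leftarrow>Ps. fact (r * card P)) * (exp z - 1) ^ card C / (z * real n) ^ (r * card C)"
proof -
  define k where "k = length Ps"
  define idx where "idx q = (SOME i. i < k \<and> q \<in> Ps ! i)" for q
  define X where "X = C \<times> {0..<r}"
  \<comment> \<open>The cyclic predecessor of the index; adding \<open>k - 1\<close> avoids
    truncated subtraction at index 0.\<close>
  define \<mu> where "\<mu> y = (idx y + (k - 1)) mod k" for y
  define F where "F = {f \<in> X \<rightarrow>\<^sub>E C. f ` X = C \<and> (\<forall>x\<in>X. \<mu> (f x) = idx (fst x))}"
  have finC: "finite C" using assms(2) by (auto intro: finite_subset)
  have UC: "\<Union>(set Ps) = C" and dj: "sorted_wrt disjnt Ps" using assms(3) by (auto simp: ordered_partitions_def)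
  have dj': "i = j" if "i < k" "j < k" "q \<in> Ps ! i" "q \<in> Ps ! j" for i j q
  proof (rule ccontr)
    assume "i \<noteq> j"
    then have "i < j \<or> j < i" by auto
    then show False using that sorted_wrt_nth_less[OF dj, of i j] sorted_wrt_nth_less[OF dj, of j i]
      by (auto simp: disjnt_def k_def)
  qed
  have idx: "idx q < k \<and> q \<in> Ps ! idx q" if "q \<in> C" for q
  proof -
    have "\<exists>i. i < k \<and> q \<in> Ps ! i" using that unfolding UC[symmetric] k_def
      by (auto simp: in_set_conv_nth)
    then show ?thesis unfolding idx_def by (rule someI_ex)
  qed
  have idx_eq: "idx q = i" if "i < k" "q \<in> Ps ! i" for q i
  proof -
    have "q \<in> C" using that UC by (auto simp: k_def)
    then show ?thesis using idx[of q] dj' that by auto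
  qed
  have "{A. cyclic r A Ps} \<subseteq> {A. restrict_trans r C A \<in> F}"
  proof
    fix A assume "A \<in> {A. cyclic r A Ps}"
    then have t1: "tau_1 r A C = C" and cyc: "\<And>i. i < k \<Longrightarrow> tau_1 r A (Ps ! i) \<subseteq> Ps ! ((i + 1) mod k)"
      by (auto simp: cyclic_def UC k_def)
    have im: "restrict_trans r C A ` X = C"
    proof -
      have "restrict_trans r C A ` X = tau_1 r A C"
        by (force simp: restrict_trans_def tau_1_def X_def image_def)
      then show ?thesis using t1 by simp
    qed
    have "\<mu> (restrict_trans r C A x) = idx (fst x)" if x: "x \<in> X" for x
    proof -
      obtain q a where qa: "x = (q, a)" "q \<in> C" "a < r" using x by (auto simp: X_def)
      have "trans A q a \<in> tau_1 r A (Ps ! idx q)" using qa idx[OF qa(2)] by (auto simp: tau_1_def)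
      then have "trans A q a \<in> Ps ! ((idx q + 1) mod k)" using cyc idx[OF qa(2)] by blast
      moreover have "(idx q + 1) mod k < k" using idx[OF qa(2)] by (intro mod_less_divisor) auto
      ultimately have "idx (trans A q a) = (idx q + 1) mod k" by (intro idx_eq)
      then have "\<mu> (trans A q a) = (idx q + 1 + (k - 1)) mod k" by (simp add: \<mu>_def mod_simps)
      also have "\<dots> = idx q" using idx[OF qa(2)] by simp
      finally show ?thesis using qa by (simp add: restrict_trans_def)
    qed
    moreover have "restrict_trans r C A \<in> X \<rightarrow>\<^sub>E C"
      using im by (auto simp: restrict_trans_def X_def)
    ultimately show "A \<in> {A. restrict_trans r C A \<in> F}" using im by (auto simp: F_def)
  qed
  then have "measure_pmf.prob (random_dfa n r) {A. cyclic r A Ps} \<le>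
      measure_pmf.prob (random_dfa n r) {A. restrict_trans r C A \<in> F}"
    by (intro measure_pmf.finite_measure_mono) auto
  also have "\<dots> \<le> real (card F) / real n ^ (r * card C)"
  proof (intro prob_restrict_trans_le assms)
    show "finite F" unfolding F_def using finC
      by (intro finite_subset[OF _ finite_PiE[of X "\<lambda>_. C"]]) (auto simp: X_def)
  qed
  also have "\<dots> \<le> ((\<Prod>i\<in>{..<k}. fact (card {x\<in>X. idx (fst x) = i})) * (exp z - 1) ^ card C / z ^ card X)
      / real n ^ (r * card C)"
  proof (rule divide_right_mono)
    show "real (card F) \<le> (\<Prod>i\<in>{..<k}. fact (card {x\<in>X. idx (fst x) = i})) * (exp z - 1) ^ card C / z ^ card X"
      unfolding F_def
    proof (rule card_colored_surj_le)
      show "(\<lambda>x. idx (fst x)) ` X \<subseteq> {..<k}" using idx by (auto simp: X_def)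
    qed (use finC assms(4) in \<open>auto simp: X_def\<close>)
  qed simp
  also have "(\<Prod>i\<in>{..<k}. fact (card {x\<in>X. idx (fst x) = i})) = (\<Prod>i\<in>{..<k}. fact (r * card (Ps ! i)) :: real)"
  proof (rule prod.cong)
    fix i assume i: "i \<in> {..<k}"
    have "Ps ! i \<subseteq> C" using i UC by (auto simp: k_def)
    then have sub: "q \<in> Ps ! i \<Longrightarrow> q \<in> C" for q by blast
    have iff: "idx q = i \<longleftrightarrow> q \<in> Ps ! i" if "q \<in> C" for q
      using i idx[OF that] idx_eq[of i q] by blast
    have "{x\<in>X. idx (fst x) = i} = Ps ! i \<times> {0..<r}"
    proof (intro set_eqI)
      fix x :: "nat \<times> nat"
      show "x \<in> {x\<in>X. idx (fst x) = i} \<longleftrightarrow> x \<in> Ps ! i \<times> {0..<r}"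
        using iff[of "fst x"] sub[of "fst x"] by (cases x; cases "fst x \<in> C") (auto simp: X_def)
    qed
    then show "fact (card {x\<in>X. idx (fst x) = i}) = (fact (r * card (Ps ! i)) :: real)"
      by (simp add: card_cartesian_product mult.commute)
  qed simp
  also have "\<dots> = (\<Prod>P\<leftarrow>Ps. fact (r * card P))"
    by (simp add: prod.list_conv_set_nth k_def atLeast0LessThan)
  also have "card X = r * card C" by (simp add: X_def card_cartesian_product)
  also have "(\<Prod>P\<leftarrow>Ps. fact (r * card P)) * (exp z - 1) ^ card C / z ^ (r * card C) / real n ^ (r * card C) =
      (\<Prod>P\<leftarrow>Ps. fact (r * card P)) * (exp z - 1) ^ card C / (z * real n) ^ (r * card C)"
    by (simp add: power_mult_distrib)
  finally show ?thesis .
qed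

section \<open>Comparison with a binomial distribution\<close>

text \<open>The induction step is \<open>(m / (m + 1)) ^ (m + 1) \<le> exp (-1)\<close>, which
  follows from \<open>1 + x \<le> exp x\<close> at \<open>x = - 1 / (m + 1)\<close>.\<close>

lemma fact_le_Stirling:
  assumes "m > 0"
  shows "fact m \<le> exp 1 * real m * (real m / exp 1) ^ m"
  using assms
proof (induction m rule: nat_induct_non_zero)
  case (Suc m)
  define x where "x = real m / real (Suc m)"
  have "x = 1 + - (1 / real (Suc m))" by (simp add: x_def field_simps)
  then have "x \<le> exp (- (1 / real (Suc m)))" by (metis exp_ge_add_one_self)
  then have "x ^ Suc m \<le> exp (- (1 / real (Suc m))) ^ Suc m"
    by (intro power_mono) (auto simp: x_def)
  also have "\<dots> = exp (-1)" by (subst exp_of_nat_mult[symmetric]) simp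
  finally have *: "real m ^ Suc m \<le> exp (-1) * real (Suc m) ^ Suc m"
    by (simp add: x_def power_divide divide_le_eq del: power_Suc)
  have "fact (Suc m) = real (Suc m) * fact m" by simp
  also have "\<dots> \<le> real (Suc m) * (exp 1 * real m * (real m / exp 1) ^ m)"
    using Suc by (intro mult_left_mono) auto
  also have "\<dots> = real (Suc m) * exp 1 * real m ^ Suc m / exp 1 ^ m" by (simp add: power_divide)
  also have "\<dots> \<le> real (Suc m) * exp 1 * (exp (-1) * real (Suc m) ^ Suc m) / exp 1 ^ m"
    using * by (intro divide_right_mono mult_left_mono) auto
  also have "\<dots> = exp 1 * real (Suc m) * (real (Suc m) / exp 1) ^ Suc m"
    by (simp add: power_divide exp_minus field_simps)
  finally show ?case .
qed simp

text \<open>With \<open>z = r a / n\<close> the generating-function bound on surjections turns into a binomial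
  probability: \<open>(exp z - 1) ^ a * exp (- z * n) = (1 - exp (- z)) ^ a * exp (- z) ^ (n - a)\<close>.\<close>
lemma choose_surj_le_binomial:
  fixes n a r :: nat
  assumes "0 < a" "a \<le> n" "0 < r"
  defines "z \<equiv> real (r * a) / real n"
  shows "real (n choose a) * fact (r * a) * (exp z - 1) ^ a / (z * real n) ^ (r * a)
    \<le> exp 1 * real (r * a) * pmf (binomial_pmf n (1 - exp (- z))) a"
proof -
  define m where "m = r * a"
  have n0: "n > 0" and m0: "m > 0" using assms by (auto simp: m_def)
  have z0: "z > 0" using n0 m0 by (simp add: z_def m_def[symmetric])
  have zn: "z * real n = real m" using n0 by (simp add: z_def m_def)
  have E: "(exp z - 1) ^ a / exp 1 ^ m = (1 - exp (- z)) ^ a * exp (- z) ^ (n - a)"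
  proof -
    have "exp 1 ^ m = exp z ^ n" using zn by (simp add: exp_of_nat_mult[symmetric] mult.commute)
    also have "\<dots> = exp z ^ a * exp z ^ (n - a)" using assms(2) by (simp add: power_add[symmetric])
    finally have "(exp z - 1) ^ a / exp 1 ^ m = ((exp z - 1) / exp z) ^ a * (1 / exp z) ^ (n - a)"
      by (simp add: power_divide)
    then show ?thesis by (simp add: diff_divide_distrib exp_minus inverse_eq_divide)
  qed
  have "real (n choose a) * fact m * (exp z - 1) ^ a / real m ^ m \<le>
      real (n choose a) * (exp 1 * real m * (real m / exp 1) ^ m) * (exp z - 1) ^ a / real m ^ m"
    using z0 m0 by (intro divide_right_mono mult_right_mono mult_left_mono fact_le_Stirling) auto
  \<comment> \<open>The power \<open>m ^ m\<close> from the Stirling bound cancels the denominator,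
    as \<open>z * n = m\<close>; what remains of it is
    \<open>exp (- m) = exp (- z * n)\<close>.\<close>
  also have "\<dots> = exp 1 * real m * (real (n choose a) * ((exp z - 1) ^ a / exp 1 ^ m))"
    using m0 by (simp add: power_divide)
  also have "\<dots> = exp 1 * real m * pmf (binomial_pmf n (1 - exp (- z))) a"
    unfolding E using z0 assms(2) by (simp add: mult.assoc)
  finally show ?thesis by (simp add: zn m_def)
qed

text \<open>Hoeffding's inequality with deviation equal to the distance of \<open>a\<close> from the
  mean, so that the point \<open>a\<close> itself lies in the tail.\<close>

lemma pmf_binomial_le_exp:
  assumes "n > 0" "0 \<le> p" "p \<le> 1"
  shows "pmf (binomial_pmf n p) a \<le> 2 * exp (- 2 * real n * (real a / real n - p)\<^sup>2)"
proof -
  interpret binomial_distribution n p by unfold_locales (use assms in auto)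
  define e where "e = \<bar>real a - real n * p\<bar>"
  have "pmf (binomial_pmf n p) a = measure_pmf.prob (binomial_pmf n p) {a}"
    by (simp add: measure_pmf_single)
  also have "\<dots> \<le> measure_pmf.prob (binomial_pmf n p) {x. \<bar>real x - real n * p\<bar> \<ge> e}"
    by (intro measure_pmf.finite_measure_mono) (auto simp: e_def)
  also have "\<dots> \<le> 2 * exp (- 2 * e\<^sup>2 / real n)"
    using prob_abs_ge[of e] assms by (auto simp: e_def)
  also have "- 2 * e\<^sup>2 / real n = - 2 * real n * (real a / real n - p)\<^sup>2"
    using assms(1) by (simp add: e_def power2_eq_square field_simps)
  finally show ?thesis by simp
qed

subsection \<open>Closed communicating classes\<close>

lemma reaches_refl: "reaches r A q q"
  unfolding reaches_def by (rule bexI[of _ "[]"]) (auto simp: trans_star_def)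

lemma reaches_trans: "reaches r A p q \<Longrightarrow> reaches r A q s \<Longrightarrow> reaches r A p s"
  unfolding reaches_def
proof (elim bexE)
  fix v w assume "v \<in> lists {0..<r}" "w \<in> lists {0..<r}" "trans_star A p v = q" "trans_star A q w = s"
  then show "\<exists>w\<in>lists {0..<r}. trans_star A p w = s"
    by (intro bexI[of _ "v @ w"]) (auto simp: trans_star_def)
qed

lemma reaches_trans_letter: "a < r \<Longrightarrow> reaches r A q (trans A q a)"
  unfolding reaches_def by (rule bexI[of _ "[a]"]) (auto simp: trans_star_def)

lemma tau_star_altdef: "tau_star r A S = {q'. \<exists>q\<in>S. reaches r A q q'}"
  by (auto simp: tau_star_def reaches_def)

lemma reaches_lt:
  assumes "A \<in> dfa_space n r" "reaches r A q q'" "q < n"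
  shows "q' < n"
proof -
  have step: "trans A q a < n" if "q < n" "a < r" for q a
  proof -
    obtain q0 t ph where A: "A = (q0, t, ph)" "t \<in> PiE {0..<n} (\<lambda>_. PiE {0..<r} (\<lambda>_. {0..<n}))"
      using assms(1) by (auto simp: dfa_space_def)
    have "t q \<in> PiE {0..<r} (\<lambda>_. {0..<n})" using A(2) that(1) by (auto simp: PiE_iff)
    then show ?thesis using that(2) by (auto simp: PiE_iff A(1) trans_def)
  qed
  obtain w where w: "w \<in> lists {0..<r}" "trans_star A q w = q'"
    using assms(2) by (auto simp: reaches_def)
  have "trans_star A q w < n"
    using w(1) assms(3)
    by (induction w arbitrary: q) (auto simp: trans_star_def step)
  then show ?thesis using w by simp
qed

lemma closed_class_subset: "closed_class n r A C \<Longrightarrow> C \<subseteq> {0..<n}"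
  unfolding closed_class_def comm_class_def by blast

lemma closed_class_nonempty:
  assumes "closed_class n r A C"
  shows "C \<noteq> {}"
proof -
  obtain q where "q \<in> {0..<n}" "C = {q' \<in> {0..<n}. communicate r A q q'}"
    using assms unfolding closed_class_def comm_class_def by blast
  then have "q \<in> C" by (simp add: communicate_def reaches_refl)
  then show ?thesis by blast
qed

text \<open>Take a state \<open>q\<close> whose reachable set is smallest. The reachable set of any
  \<open>p\<close> reachable from \<open>q\<close> is contained in that of \<open>q\<close>, hence
  equal to it by minimality, so \<open>q\<close> is reachable from \<open>p\<close>.\<close>

lemma closed_class_exists:
  assumes "A \<in> dfa_space n r" "n > 0"
  shows "\<exists>C. closed_class n r A C"
proof -
  define R where "R q = {q'. reaches r A q q'}" for q
  have fin: "finite (R q)" and sub: "R q \<subseteq> {0..<n}" if "q < n" for q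
    using reaches_lt[OF assms(1) _ that] by (auto simp: R_def intro: finite_subset[of _ "{0..<n}"])
  obtain q where q: "q < n" "\<And>p. p < n \<Longrightarrow> card (R q) \<le> card (R p)"
    using ex_has_least_nat[of "\<lambda>q. q < n" 0 "\<lambda>q. card (R q)"] assms(2) by auto
  have recur: "reaches r A p q" if "p \<in> R q" for p
  proof -
    have "p < n" using sub[OF q(1)] that by auto
    moreover have "R p \<subseteq> R q" using that by (auto simp: R_def intro: reaches_trans)
    ultimately have "R p = R q" using q fin by (intro card_seteq) auto
    then show ?thesis using reaches_refl[of r A q] by (auto simp: R_def)
  qed
  have R: "R q = {q' \<in> {0..<n}. communicate r A q q'}"
    using recur sub[OF q(1)] by (auto simp: R_def communicate_def)
  moreover have "tau_star r A (R q) = R q"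
    by (auto simp: tau_star_altdef R_def intro: reaches_trans reaches_refl)
  ultimately have "closed_class n r A (R q)"
    using q(1) unfolding closed_class_def comm_class_def by auto
  then show ?thesis ..
qed

lemma closed_class_disjoint:
  assumes "closed_class n r A C" "closed_class n r A D" "C \<inter> D \<noteq> {}"
  shows "C = D"
proof -
  obtain p q where "C = {q' \<in> {0..<n}. communicate r A p q'}" "D = {q' \<in> {0..<n}. communicate r A q q'}"
    using assms unfolding closed_class_def comm_class_def by blast
  then show ?thesis using assms(3) by (auto simp: communicate_def intro: reaches_trans)
qed

lemma closed_class_tau_1:
  assumes "closed_class n r A C" "r > 0"
  shows "tau_1 r A C = C"
proof
  have star: "tau_star r A C = C" using assms by (simp add: closed_class_def)
  have in_C: "p' \<in> C" if "p \<in> C" "reaches r A p p'" for p p'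
    using star that by (auto simp: tau_star_altdef)
  show "tau_1 r A C \<subseteq> C"
  proof
    fix y assume "y \<in> tau_1 r A C"
    then obtain q a where "q \<in> C" "a < r" "y = trans A q a" by (auto simp: tau_1_def)
    then show "y \<in> C" using in_C reaches_trans_letter by metis
  qed
  show "C \<subseteq> tau_1 r A C"
  proof
    fix y assume y: "y \<in> C"
    \<comment> \<open>A closed walk at \<open>y\<close> that begins with the letter 0 is nonempty
      even if \<open>y\<close> is the only state of the class. Its last letter therefore exhibits
      \<open>y\<close> as a one-step image of a state in \<open>C\<close>.\<close>
    have "reaches r A (trans A y 0) y"
    proof -
      obtain q where C: "C = {q' \<in> {0..<n}. communicate r A q q'}"
        using assms(1) unfolding closed_class_def comm_class_def by blast
      have "trans A y 0 \<in> C" using in_C[OF y reaches_trans_letter] assms(2) by blast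
      then show ?thesis using y unfolding C by (auto simp: communicate_def intro: reaches_trans)
    qed
    then obtain w where w: "w \<in> lists {0..<r}" "trans_star A (trans A y 0) w = y"
      by (auto simp: reaches_def)
    obtain v a where va: "0 # w = v @ [a]" by (metis rev_exhaust list.distinct(1))
    have va_lists: "v \<in> lists {0..<r}" "a < r"
      using w(1) assms(2) va by (metis Cons_in_lists_iff append_in_lists_conv atLeastLessThan_iff le0)+
    have "trans_star A y (0 # w) = y" using w(2) by (simp add: trans_star_def)
    then have "trans A (trans_star A y v) a = y" unfolding va by (simp add: trans_star_def)
    moreover have "trans_star A y v \<in> C"
      using in_C[OF y] va_lists by (auto simp: reaches_def)
    ultimately show "y \<in> tau_1 r A C" using va_lists by (force simp: tau_1_def)
  qed
qed

lemma card_tau_1_le: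
  assumes "finite S"
  shows "card (tau_1 r A S) \<le> r * card S"
proof -
  have "tau_1 r A S = (\<lambda>(q, a). trans A q a) ` (S \<times> {0..<r})" by (fastforce simp: tau_1_def)
  then show ?thesis
    using card_image_le[of "S \<times> {0..<r}" "\<lambda>(q, a). trans A q a"] assms
    by (simp add: card_cartesian_product mult.commute)
qed

text \<open>No part can dominate, since a part has at most \<open>r\<close> times the size of its predecessor.
  Hence some prefix of the cyclic partition has size bounded away from \<open>0\<close> and from \<open>card C\<close>.\<close>
lemma periodic_balanced_split:
  assumes "finite C" "C \<noteq> {}" "periodic r A k C" "tau_1 r A C = C"
  shows "\<exists>Xs Ys. Xs @ Ys \<in> ordered_partitions C \<and> cyclic r A (Xs @ Ys) \<and>
    card C \<le> 2 * (r + 1) * card (\<Union>(set Xs)) \<and> card C \<le> 2 * (r + 1) * card (C - \<Union>(set Xs))"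
proof -
  obtain P where k: "k > 1" and ne: "\<And>i. i < k \<Longrightarrow> P i \<noteq> {}" and UP: "(\<Union>i<k. P i) = C"
    and dj: "\<And>i j. i < k \<Longrightarrow> j < k \<Longrightarrow> i \<noteq> j \<Longrightarrow> P i \<inter> P j = {}"
    and cyc: "\<And>i. i < k \<Longrightarrow> tau_1 r A (P i) = P ((i + 1) mod k)"
    using assms(3) unfolding periodic_def by metis
  define a where "a = card C"
  have finP: "finite (P i)" if "i < k" for i
    using UP assms(1) that by (metis UN_upper finite_subset lessThan_iff)
  define S where "S m = card (\<Union>i<m. P i)" for m
  have S_Suc: "S (Suc m) = S m + card (P m)" if "m < k" for m
  proof -
    have "(\<Union>i<Suc m. P i) = (\<Union>i<m. P i) \<union> P m" by (auto simp: less_Suc_eq)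
    moreover have "(\<Union>i<m. P i) \<inter> P m = {}"
    proof -
      have "P i \<inter> P m = {}" if "i < m" for i using dj[of i m] that \<open>m < k\<close> by simp
      then show ?thesis by blast
    qed
    ultimately show ?thesis using finP that by (simp add: S_def card_Un_disjoint)
  qed
  \<comment> \<open>With \<open>P j\<close> the predecessor of \<open>P m\<close>, a different part
    because \<open>k > 1\<close>, one has
    \<open>card (P m) \<le> r * card (P j) \<le> r * (a - card (P m))\<close>.\<close>
  have part: "(r + 1) * card (P m) \<le> r * a" if m: "m < k" for m
  proof -
    define j where "j = (m + (k - 1)) mod k"
    have j: "j < k" "(j + 1) mod k = m" "j \<noteq> m"
    proof -
      show "j < k" using k by (simp add: j_def)
      have "(j + 1) mod k = (m + (k - 1) + 1) mod k" unfolding j_def by (rule mod_add_left_eq)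
      also have "\<dots> = m" using k m by simp
      finally show jm: "(j + 1) mod k = m" .
      show "j \<noteq> m"
      proof
        assume "j = m"
        then have "(m + 1) mod k = m" using jm by simp
        then show False using k m by (cases "m + 1 = k") auto
      qed
    qed
    have "card (P m) \<le> r * card (P j)" 
      using card_tau_1_le[OF finP[OF j(1)], of r A] cyc[OF j(1)] unfolding j(2) by simp
    moreover have "card (P j) + card (P m) \<le> a"
    proof -
      have "card (P j) + card (P m) = card (P j \<union> P m)"
        by (rule card_Un_disjoint[symmetric]) (use finP[OF j(1)] finP[OF m] dj[OF j(1) m j(3)] in auto)
      also have "\<dots> \<le> a" unfolding a_def using UP j(1) m by (intro card_mono assms(1)) blast
      finally show ?thesis .
    qed
    then have "r * card (P j) + r * card (P m) \<le> r * a"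
      by (metis add_mult_distrib2 mult_le_mono2)
    ultimately show ?thesis by simp
  qed
  have a0: "a > 0" using assms by (simp add: a_def card_gt_0_iff)
  have Sk: "S k = a" using UP by (simp add: S_def a_def)
  \<comment> \<open>The shortest prefix containing a fraction \<open>1 / (2 * (r + 1))\<close> of
    \<open>C\<close>. Without its last part it is below this fraction, and that part has fraction at
    most \<open>r / (r + 1)\<close>, so at least \<open>1 / (2 * (r + 1))\<close> is left outside
    the prefix.\<close>
  define m where "m = (LEAST m. a \<le> 2 * (r + 1) * S m)"
  have m1: "a \<le> 2 * (r + 1) * S m" unfolding m_def by (rule LeastI[of _ k]) (simp add: Sk)
  have mk: "m \<le> k" unfolding m_def by (rule Least_le) (simp add: Sk)
  have "m \<noteq> 0"
  proof
    assume "m = 0"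
    then show False using m1 a0 by (simp add: S_def)
  qed
  then obtain l where l: "m = Suc l" using not0_implies_Suc by blast
  have "\<not> a \<le> 2 * (r + 1) * S l" using not_less_Least[of l "\<lambda>m. a \<le> 2 * (r + 1) * S m"] l
    by (simp add: m_def)
  then have "2 * (r * S l) + 2 * S l < a" by simp
  moreover have "r * card (P l) + card (P l) \<le> r * a" using part[of l] l mk by simp
  moreover have "S m = S l + card (P l)" using S_Suc[of l] l mk by simp
  moreover have "r * S m = r * S l + r * card (P l)" using calculation(3) by (simp add: add_mult_distrib2)
  ultimately have m2: "2 * (r * S m) + 2 * S m + a \<le> 2 * (r * a) + 2 * a" by linarith
  define Xs where "Xs = map P [0..<m]"
  define Ys where "Ys = map P [m..<k]"
  have app: "Xs @ Ys = map P [0..<k]"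
    unfolding Xs_def Ys_def using mk by (metis map_append upt_add_eq_append le_add_diff_inverse le0)
  have UX: "\<Union>(set Xs) = (\<Union>i<m. P i)" by (auto simp: Xs_def)
  have sub: "\<Union>(set Xs) \<subseteq> C" unfolding UX using UP mk by fastforce
  have "Xs @ Ys \<in> ordered_partitions C"
    unfolding app ordered_partitions_def using ne UP dj
    by (auto simp: sorted_wrt_map sorted_wrt_iff_nth_less disjnt_def atLeast0LessThan)
  moreover have "cyclic r A (Xs @ Ys)"
  proof -
    have "\<Union>(set (Xs @ Ys)) = C" unfolding app using UP by auto
    moreover have "(i + 1) mod k < k" for i using k by simp
    ultimately show ?thesis using assms(4) cyc by (simp add: cyclic_def app)
  qed
  moreover have "card C \<le> 2 * (r + 1) * card (\<Union>(set Xs))" using m1 by (simp add: UX S_def a_def)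
  moreover have "card C \<le> 2 * (r + 1) * card (C - \<Union>(set Xs))"
  proof -
    have "S m + card (C - \<Union>(set Xs)) = a"
      using sub assms(1) by (simp add: card_Diff_subset finite_subset card_mono UX S_def a_def)
    moreover have "r * S m + r * card (C - \<Union>(set Xs)) = r * a"
      using calculation by (metis add_mult_distrib2)
    ultimately show ?thesis using m2 by (simp add: a_def)
  qed
  ultimately show ?thesis by blast
qed

subsection \<open>First moment bounds\<close>

text \<open>First moment bound for self-covering sets of size \<open>a\<close>: the number of
  \<open>a\<close>-subsets times the bound of \<open>prob_cyclic_le\<close> for one block. The
  choice \<open>z = r * a / n\<close> makes \<open>1 - exp (- z)\<close> approximately the expected
  fraction of states hit by \<open>r * a\<close> random transitions.\<close>

definition occupancy :: "nat \<Rightarrow> nat \<Rightarrow> nat \<Rightarrow> real" where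
  "occupancy n r a = (let z = real (r * a) / real n in
     real (n choose a) * (fact (r * a) * (exp z - 1) ^ a / (z * real n) ^ (r * a)))"

lemma occupancy_le_binomial:
  assumes "0 < a" "a \<le> n" "0 < r"
  shows "occupancy n r a \<le>
    exp 1 * real (r * n) * pmf (binomial_pmf n (1 - exp (- (real r * (real a / real n))))) a"
proof -
  have "occupancy n r a \<le>
      exp 1 * real (r * a) * pmf (binomial_pmf n (1 - exp (- (real (r * a) / real n)))) a"
    using choose_surj_le_binomial[OF assms] by (simp add: occupancy_def Let_def mult.assoc)
  also have "\<dots> \<le> exp 1 * real (r * n) * pmf (binomial_pmf n (1 - exp (- (real (r * a) / real n)))) a"
    using assms by (intro mult_right_mono mult_left_mono pmf_nonneg) auto
  finally show ?thesis by simp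
qed

lemma sum_half_powers_le: "(\<Sum>a\<le>N. real a * (1 / 2) ^ a) \<le> 2"
proof -
  have "(\<Sum>a\<le>N. real a * (1 / 2) ^ a) = 2 - real (N + 2) * (1 / 2) ^ N"
    by (induction N) (simp_all add: field_simps)
  then show ?thesis by simp
qed

text \<open>With \<open>x = a / n\<close> and \<open>r \<ge> 2\<close> there are at least two
  factors \<open>x ^ a\<close>. One turns \<open>n ^ a / fact a\<close> into
  \<open>a ^ a / fact a\<close>, which is at most \<open>exp a \<le> 3 ^ a\<close>; the other
  survives.\<close>

lemma choose_closed_le:
  assumes "0 < a" "a \<le> n" "r \<ge> 2"
  shows "real (n choose a) * (real a / real n) ^ (r * a) \<le> (3 * (real a / real n)) ^ a"
proof -
  define x where "x = real a / real n"
  have x: "0 \<le> x" "x \<le> 1" using assms by (auto simp: x_def)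
  have nx: "real n * x = real a" using assms by (simp add: x_def)
  have "real ((n choose a) * fact a) \<le> real (n ^ a)"
    by (rule of_nat_mono[OF binomial_fact_pow])
  then have "real (n choose a) \<le> real n ^ a / fact a" by (simp add: field_simps)
  moreover have "x ^ (r * a) \<le> x ^ (2 * a)"
    using x assms by (intro power_decreasing) auto
  ultimately have "real (n choose a) * x ^ (r * a) \<le> real n ^ a / fact a * x ^ (2 * a)"
    using x by (intro mult_mono) auto
  also have "\<dots> = (real n * x) ^ a / fact a * x ^ a"
    by (simp add: power_mult_distrib power_mult[symmetric] mult_2 power_add)
  also have "\<dots> \<le> 3 ^ a * x ^ a"
  proof (rule mult_right_mono)
    have "(\<Sum>k\<in>{a}. real a ^ k /\<^sub>R fact k) \<le> exp (real a)"
      unfolding exp_def using summable_exp_generic[of "real a"] by (intro sum_le_suminf) auto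
    then have "real a ^ a / fact a \<le> exp (real a)" by (simp add: divide_inverse mult.commute)
    also have "\<dots> = exp 1 ^ a" by (simp add: exp_of_nat_mult[symmetric])
    also have "\<dots> \<le> 3 ^ a" by (intro power_mono exp_le) auto
    finally show "(real n * x) ^ a / fact a \<le> 3 ^ a" by (simp add: nx)
  qed (use x in auto)
  finally show ?thesis unfolding x_def power_mult_distrib .
qed

text \<open>For \<open>a \<le> n / 6\<close> the base \<open>3 * a / n\<close> of
  \<open>choose_closed_le\<close> is at most 1/2. Keeping one factor \<open>3 * a / n\<close> for
  the decay in \<open>n\<close> and bounding the others by 1/2 leaves a convergent series in
  \<open>a\<close>.\<close>

lemma prob_small_closed_le:
  assumes "n > 0" "r \<ge> 2"
  shows "measure_pmf.prob (random_dfa n r)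
    {A. \<exists>C\<in>{C\<in>Pow {0..<n}. C \<noteq> {} \<and> 6 * card C \<le> n}. tau_1 r A C \<subseteq> C} \<le> 12 / real n"
proof -
  let ?I = "{C\<in>Pow {0..<n}. C \<noteq> {} \<and> 6 * card C \<le> n}"
  \<comment> \<open>The value 0 outside the admissible range allows summing over all subsets and
    grouping them by size.\<close>
  define f where "f a = (if a = 0 \<or> n < 6 * a then 0 else (real a / real n) ^ (r * a))" for a
  have f0: "f a \<ge> 0" for a by (simp add: f_def)
  have "measure_pmf.prob (random_dfa n r) {A. \<exists>C\<in>?I. tau_1 r A C \<subseteq> C} \<le>
      (\<Sum>C\<in>?I. measure_pmf.prob (random_dfa n r) {A. tau_1 r A C \<subseteq> C})"
    by (rule prob_bex_le) auto
  also have "\<dots> \<le> (\<Sum>C\<in>?I. f (card C))"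
  proof (rule sum_mono)
    fix C assume C: "C \<in> ?I"
    then have "card C \<noteq> 0" by (auto dest: finite_subset)
    then show "measure_pmf.prob (random_dfa n r) {A. tau_1 r A C \<subseteq> C} \<le> f (card C)"
      using C prob_closed_le[OF assms(1), of C r] by (simp add: f_def)
  qed
  also have "\<dots> \<le> (\<Sum>C\<in>Pow {0..<n}. f (card C))"
    using f0 by (intro sum_mono2) auto
  also have "\<dots> = (\<Sum>a\<le>n. real (n choose a) * f a)"
    using sum_card_Pow[of "{0..<n}" f] by simp
  also have "\<dots> \<le> (\<Sum>a\<le>n. 6 / real n * (real a * (1 / 2) ^ a))"
  proof (rule sum_mono)
    fix a assume "a \<in> {..n}"
    show "real (n choose a) * f a \<le> 6 / real n * (real a * (1 / 2) ^ a)"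
    proof (cases "a = 0 \<or> n < 6 * a")
      case False
      then obtain b where b: "a = Suc b" using not0_implies_Suc by blast
      have half: "3 * (real a / real n) \<le> 1 / 2" using False assms by (simp add: field_simps)
      have "real (n choose a) * f a \<le> (3 * (real a / real n)) ^ a"
        using False assms choose_closed_le[of a n r] by (auto simp: f_def)
      also have "\<dots> \<le> 3 * (real a / real n) * (1 / 2) ^ b"
        unfolding b power_Suc using half[unfolded b] by (intro mult_left_mono power_mono) auto
      also have "\<dots> = 6 / real n * (real a * (1 / 2) ^ a)" by (simp add: b)
      finally show ?thesis .
    qed (auto simp: f_def)
  qed
  also have "\<dots> \<le> 6 / real n * 2"
    unfolding sum_distrib_left[symmetric] by (intro mult_left_mono sum_half_powers_le) auto
  finally show ?thesis by simp
qed

text \<open>The weight \<open>w\<close> compares the event \<open>Q C\<close> with the surjectivity of the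
  transitions of \<open>C\<close> onto \<open>C\<close>, the case \<open>w = 1\<close>.\<close>
lemma prob_bex_set_le:
  assumes "n > 0" "r > 0"
    and "\<And>C. C \<subseteq> {0..<n} \<Longrightarrow> 0 < card C \<Longrightarrow> J (card C) \<Longrightarrow>
      measure_pmf.prob (random_dfa n r) {A. Q C A} \<le> w (card C) *
        (let z = real (r * card C) / real n in
         fact (r * card C) * (exp z - 1) ^ card C / (z * real n) ^ (r * card C))"
    and "\<And>a. 0 < a \<Longrightarrow> a \<le> n \<Longrightarrow> J a \<Longrightarrow> w a * occupancy n r a \<le> b"
    and "b \<ge> 0"
  shows "measure_pmf.prob (random_dfa n r)
    {A. \<exists>C\<in>{C\<in>Pow {0..<n}. 0 < card C \<and> J (card C)}. Q C A} \<le> real (n + 1) * b"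
proof -
  let ?I = "{C\<in>Pow {0..<n}. 0 < card C \<and> J (card C)}"
  define y where "y a = (let z = real (r * a) / real n in
     fact (r * a) * (exp z - 1) ^ a / (z * real n) ^ (r * a))" for a
  define f where "f a = (if 0 < a \<and> J a then w a * y a else 0)" for a
  have "measure_pmf.prob (random_dfa n r) {A. \<exists>C\<in>?I. Q C A} \<le>
      (\<Sum>C\<in>?I. measure_pmf.prob (random_dfa n r) {A. Q C A})"
    by (rule prob_bex_le) auto
  also have "\<dots> \<le> (\<Sum>C\<in>?I. f (card C))"
    using assms(3) by (intro sum_mono) (auto simp: f_def y_def)
  also have "\<dots> = (\<Sum>C\<in>Pow {0..<n}. f (card C))"
    by (intro sum.mono_neutral_left) (auto simp: f_def)
  also have "\<dots> = (\<Sum>a\<le>n. real (n choose a) * f a)"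
    using sum_card_Pow[of "{0..<n}" f] by simp
  also have "\<dots> \<le> (\<Sum>a\<le>n. b)"
  proof (rule sum_mono)
    fix a assume a: "a \<in> {..n}"
    show "real (n choose a) * f a \<le> b"
    proof (cases "0 < a \<and> J a")
      case True
      have "real (n choose a) * f a = w a * occupancy n r a"
        using True by (simp add: f_def y_def occupancy_def Let_def)
      then show ?thesis using assms(4)[of a] True a by simp
    next
      case False
      then have "f a = 0" by (simp only: f_def if_False)
      then show ?thesis using assms(5) by simp
    qed
  qed
  finally show ?thesis by simp
qed

text \<open>The separation constant \<open>\<kappa>\<close> converts a deviation of more than
  \<open>g\<close> from \<open>c * n\<close> into a distance of at least
  \<open>\<kappa> * g / n\<close> between \<open>a / n\<close> and the binomial parameter, to which
  Hoeffding's bound applies.\<close>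

lemma prob_atypical_size_le:
  assumes "n > 0" "r > 0" "\<kappa> \<ge> 0" "g \<ge> 0"
    and \<kappa>: "\<And>x. x \<ge> 1 / 6 \<Longrightarrow> \<kappa> * \<bar>x - c\<bar> \<le> \<bar>x - (1 - exp (- (real r * x)))\<bar>"
  shows "measure_pmf.prob (random_dfa n r)
    {A. \<exists>C\<in>{C\<in>Pow {0..<n}. 0 < card C \<and> n \<le> 6 * card C \<and> \<bar>real (card C) - c * real n\<bar> > g}.
        tau_1 r A C = C}
    \<le> real (n + 1) * (exp 1 * real (r * n) * (2 * exp (- (2 * \<kappa>\<^sup>2 * g\<^sup>2 / real n))))"
proof (rule prob_bex_set_le[where w = "\<lambda>_. 1" and J = "\<lambda>a. n \<le> 6 * a \<and> \<bar>real a - c * real n\<bar> > g"])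
  fix C assume C: "C \<subseteq> {0..<n}" "0 < card C"
  then have C0: "C \<noteq> {}" by auto
  then have P: "[C] \<in> ordered_partitions C" by (simp add: ordered_partitions_def)
  have "real (r * card C) / real n > 0" using assms C by simp
  from prob_cyclic_le[OF assms(1) C(1) P this, of r]
  have "measure_pmf.prob (random_dfa n r) {A. cyclic r A [C]} \<le>
        (let z = real (r * card C) / real n in
         fact (r * card C) * (exp z - 1) ^ card C / (z * real n) ^ (r * card C))"
    by (simp add: Let_def)
  moreover have "{A. cyclic r A [C]} = {A. tau_1 r A C = C}"
    by (auto simp: cyclic_def)
  ultimately show "measure_pmf.prob (random_dfa n r) {A. tau_1 r A C = C} \<le> 1 *
        (let z = real (r * card C) / real n in
         fact (r * card C) * (exp z - 1) ^ card C / (z * real n) ^ (r * card C))"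
    by simp
next
  fix a assume a: "0 < a" "a \<le> n" "n \<le> 6 * a \<and> \<bar>real a - c * real n\<bar> > g"
  define x where "x = real a / real n"
  define p where "p = 1 - exp (- (real r * x))"
  have p: "0 \<le> p" "p \<le> 1" by (auto simp: p_def x_def)
  have "x \<ge> 1 / 6" using a assms(1) by (simp add: x_def field_simps)
  then have "\<kappa> * \<bar>x - c\<bar> \<le> \<bar>x - p\<bar>" unfolding p_def by (rule \<kappa>)
  moreover have "g / real n \<le> \<bar>x - c\<bar>"
  proof -
    have "x - c = (real a - c * real n) / real n" using assms(1) by (simp add: x_def field_simps)
    then have "\<bar>x - c\<bar> = \<bar>real a - c * real n\<bar> / real n" by simp
    then show ?thesis using a assms(1) by (simp add: divide_right_mono)
  qed
  then have "\<kappa> * (g / real n) \<le> \<kappa> * \<bar>x - c\<bar>" using assms(3) by (rule mult_left_mono)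
  ultimately have "\<kappa> * (g / real n) \<le> \<bar>x - p\<bar>" by linarith
  then have "(\<kappa> * (g / real n))\<^sup>2 \<le> \<bar>x - p\<bar>\<^sup>2"
    using assms by (intro power_mono) auto
  then have "2 * real n * (\<kappa> * (g / real n))\<^sup>2 \<le> 2 * real n * (x - p)\<^sup>2"
    by (intro mult_left_mono) auto
  moreover have "2 * real n * (\<kappa> * (g / real n))\<^sup>2 = 2 * \<kappa>\<^sup>2 * g\<^sup>2 / real n"
    using assms(1) by (simp add: power2_eq_square field_simps)
  ultimately have ex: "exp (- 2 * real n * (x - p)\<^sup>2) \<le> exp (- (2 * \<kappa>\<^sup>2 * g\<^sup>2 / real n))" by simp
  have "occupancy n r a \<le> exp 1 * real (r * n) * pmf (binomial_pmf n p) a"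
    unfolding p_def x_def using a assms by (intro occupancy_le_binomial) auto
  also have "\<dots> \<le> exp 1 * real (r * n) * (2 * exp (- (2 * \<kappa>\<^sup>2 * g\<^sup>2 / real n)))"
  proof (rule mult_left_mono)
    have "pmf (binomial_pmf n p) a \<le> 2 * exp (- 2 * real n * (x - p)\<^sup>2)"
      unfolding x_def by (rule pmf_binomial_le_exp[OF assms(1) p])
    then show "pmf (binomial_pmf n p) a \<le> 2 * exp (- (2 * \<kappa>\<^sup>2 * g\<^sup>2 / real n))"
      using ex by linarith
  qed simp
  finally show "1 * occupancy n r a \<le> exp 1 * real (r * n) * (2 * exp (- (2 * \<kappa>\<^sup>2 * g\<^sup>2 / real n)))"
    by simp
qed (use assms in auto)

section \<open>Periodic classes\<close>

text \<open>The consequence of periodicity that enters the union bound: a cyclic partition cut into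
  two consecutive blocks of parts, neither of them negligible.\<close>

definition splits :: "nat \<Rightarrow> nat set \<Rightarrow> dfa \<Rightarrow> bool" where
  "splits r C A \<longleftrightarrow> (\<exists>Xs Ys. Xs @ Ys \<in> ordered_partitions C \<and> cyclic r A (Xs @ Ys) \<and>
    card C \<le> 2 * (r + 1) * card (\<Union>(set Xs)) \<and> card C \<le> 2 * (r + 1) * card (C - \<Union>(set Xs)))"

text \<open>For \<open>2 * s \<le> a\<close> use
  \<open>(a choose s) \<ge> (a / s) ^ s \<ge> 2 ^ s\<close>; the other half follows by symmetry of
  the binomial coefficient.\<close>

lemma two_power_le_choose:
  assumes "s \<le> a" "d \<le> s" "d \<le> a - s"
  shows "2 ^ d \<le> real (a choose s)"
proof -
  have *: "2 ^ d \<le> real (a choose s)" if "2 * s \<le> a" "d \<le> s" for s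
  proof (cases "s = 0")
    case False
    have "(2::real) ^ d \<le> 2 ^ s" using that by simp
    also have "\<dots> \<le> (real a / real s) ^ s"
      using that False by (intro power_mono) (simp_all add: field_simps)
    also have "\<dots> \<le> real (a choose s)" using that by (intro binomial_ge_n_over_k_pow_k) auto
    finally show ?thesis .
  qed (use that in simp)
  show ?thesis
  proof (cases "2 * s \<le> a")
    case True then show ?thesis using *[of s] assms by simp
  next
    case False
    then have "2 ^ d \<le> real (a choose (a - s))" using assms by (intro *) auto
    then show ?thesis using binomial_symmetric[OF assms(1)] by simp
  qed
qed

text \<open>Union bound over the set \<open>U\<close> covered by the first block and over the
  ordered partitions of \<open>U\<close> and \<open>C - U\<close>. Each of the two partition sums
  costs a factor \<open>card C\<close> by \<open>sum_ordered_partitions_le\<close>. Choosing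
  \<open>U\<close> of size \<open>s\<close> and merging the two factorials leaves
  \<open>fact (r * card C) / (card C choose s)\<close>, and balance of the cut makes this binomial
  coefficient at least \<open>2 ^ d\<close>. The factor \<open>card C + 1\<close> counts the sizes
  \<open>s\<close>.\<close>

lemma prob_splits_le:
  assumes "n > 0" "r \<ge> 2" "C \<subseteq> {0..<n}" "z > 0" "2 * (r + 1) * d \<le> card C" "card C > 0"
  shows "measure_pmf.prob (random_dfa n r) {A. splits r C A} \<le>
    real (card C) ^ 2 * real (card C + 1) / 2 ^ d *
      (fact (r * card C) * (exp z - 1) ^ card C / (z * real n) ^ (r * card C))"
proof -
  define a where "a = card C"
  define y where "y = (exp z - 1) ^ a / (z * real n) ^ (r * a)"
  have y0: "y \<ge> 0" using assms by (simp add: y_def)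
  have finC: "finite C" using assms(3) by (auto intro: finite_subset)
  define L where "L S = (\<Sum>Ps\<in>ordered_partitions S. \<Prod>P\<leftarrow>Ps. fact (r * card P) :: real)" for S :: "nat set"
  have L0: "L S \<ge> 0" for S unfolding L_def by (intro sum_nonneg prod_list_nonneg) auto
  have L_le: "L S \<le> real a * fact (r * card S)" if "S \<subseteq> C" for S
  proof -
    have "finite S" using that finC by (rule finite_subset)
    then have "L S \<le> real (max 1 (card S)) * fact (r * card S)"
      unfolding L_def by (rule sum_ordered_partitions_le[OF assms(2)])
    also have "real (max 1 (card S)) \<le> real a"
      using card_mono[OF finC that] assms(6) by (simp add: a_def)
    finally show ?thesis by simp
  qed
  define good where "good s \<longleftrightarrow> a \<le> 2 * (r + 1) * s \<and> a \<le> 2 * (r + 1) * (a - s)" for s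
  define Us where "Us = {U\<in>Pow C. good (card U)}"
  define I where "I = (SIGMA U:Us. ordered_partitions U \<times> ordered_partitions (C - U))"
  have finI: "finite I" unfolding I_def Us_def using finC
    by (intro finite_SigmaI finite_cartesian_product finite_ordered_partitions) (auto intro: finite_subset)
  have finUs: "finite Us" using finC by (simp add: Us_def)
  have "{A. splits r C A} \<subseteq> {A. \<exists>i\<in>I. cyclic r A (fst (snd i) @ snd (snd i))
      \<and> fst (snd i) @ snd (snd i) \<in> ordered_partitions C}"
  proof
    fix A assume "A \<in> {A. splits r C A}"
    then obtain Xs Ys where XY: "Xs @ Ys \<in> ordered_partitions C" "cyclic r A (Xs @ Ys)"
      "a \<le> 2 * (r + 1) * card (\<Union>(set Xs))" "a \<le> 2 * (r + 1) * card (C - \<Union>(set Xs))"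
      by (auto simp: splits_def a_def)
    let ?U = "\<Union>(set Xs)"
    have U: "?U \<subseteq> C" using XY(1) by (auto simp: ordered_partitions_def)
    then have "card (C - ?U) = a - card ?U" using finC by (simp add: card_Diff_subset finite_subset a_def)
    then have "?U \<in> Us" using U XY by (simp add: Us_def good_def)
    moreover have "Xs \<in> ordered_partitions ?U"
      using XY(1) by (auto simp: ordered_partitions_def sorted_wrt_append)
    moreover have "Ys \<in> ordered_partitions (C - ?U)"
    proof -
      have "\<Union>(set Xs) \<union> \<Union>(set Ys) = C" and "\<forall>X\<in>set Xs. \<forall>Y\<in>set Ys. X \<inter> Y = {}"
        using XY(1) by (auto simp: ordered_partitions_def sorted_wrt_append disjnt_def)
      then have "\<Union>(set Ys) = C - ?U" by blast
      then show ?thesis using XY(1) by (simp add: ordered_partitions_def sorted_wrt_append)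
    qed
    ultimately have "(?U, Xs, Ys) \<in> I" by (simp add: I_def)
    then show "A \<in> {A. \<exists>i\<in>I. cyclic r A (fst (snd i) @ snd (snd i))
        \<and> fst (snd i) @ snd (snd i) \<in> ordered_partitions C}"
      using XY by force
  qed
  then have "measure_pmf.prob (random_dfa n r) {A. splits r C A} \<le>
      measure_pmf.prob (random_dfa n r) {A. \<exists>i\<in>I. cyclic r A (fst (snd i) @ snd (snd i))
        \<and> fst (snd i) @ snd (snd i) \<in> ordered_partitions C}"
    by (intro measure_pmf.finite_measure_mono) auto
  also have "\<dots> \<le> (\<Sum>i\<in>I. measure_pmf.prob (random_dfa n r) {A. cyclic r A (fst (snd i) @ snd (snd i))
      \<and> fst (snd i) @ snd (snd i) \<in> ordered_partitions C})"
    by (rule prob_bex_le) fact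
  also have "\<dots> \<le> (\<Sum>i\<in>I. (\<Prod>P\<leftarrow>fst (snd i). fact (r * card P)) * (\<Prod>P\<leftarrow>snd (snd i). fact (r * card P)) * y)"
  proof (rule sum_mono)
    fix i :: "nat set \<times> nat set list \<times> nat set list"
    let ?Ps = "fst (snd i) @ snd (snd i)"
    show "measure_pmf.prob (random_dfa n r) {A. cyclic r A ?Ps \<and> ?Ps \<in> ordered_partitions C}
        \<le> (\<Prod>P\<leftarrow>fst (snd i). fact (r * card P)) * (\<Prod>P\<leftarrow>snd (snd i). fact (r * card P)) * y"
    \<comment> \<open>Membership in \<open>ordered_partitions C\<close> is part of the event, which
      is therefore empty when the concatenation is not a partition of \<open>C\<close>.\<close>
    proof (cases "?Ps \<in> ordered_partitions C")
      case True
      then show ?thesis using prob_cyclic_le[OF assms(1,3) True assms(4), of r]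
        by (simp add: y_def a_def)
    next
      case False
      have "0 \<le> (\<Prod>P\<leftarrow>fst (snd i). fact (r * card P)) * (\<Prod>P\<leftarrow>snd (snd i). fact (r * card P)) * y"
        by (intro mult_nonneg_nonneg y0 prod_list_nonneg) auto
      then show ?thesis using False by simp
    qed
  qed
  also have "\<dots> = (\<Sum>U\<in>Us. \<Sum>XY\<in>ordered_partitions U \<times> ordered_partitions (C - U).
      (\<Prod>P\<leftarrow>fst XY. fact (r * card P)) * (\<Prod>P\<leftarrow>snd XY. fact (r * card P)) * y)"
    unfolding I_def using finUs finC
    by (subst sum.Sigma) (auto simp: case_prod_unfold Us_def intro!: finite_cartesian_product finite_ordered_partitions
          intro: finite_subset)
  also have "\<dots> = (\<Sum>U\<in>Us. L U * L (C - U) * y)"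
    by (intro sum.cong refl)
      (simp add: L_def sum_product sum_distrib_right[symmetric] sum.cartesian_product case_prod_unfold)
  also have "\<dots> \<le> (\<Sum>U\<in>Us. real a ^ 2 * (fact (r * card U) * fact (r * (a - card U))) * y)"
  proof (intro sum_mono mult_right_mono y0)
    fix U assume "U \<in> Us"
    then have U: "U \<subseteq> C" by (simp add: Us_def)
    have "L U * L (C - U) \<le> (real a * fact (r * card U)) * (real a * fact (r * card (C - U)))"
      using U by (intro mult_mono L_le L0) auto
    also have "card (C - U) = a - card U" using U finC by (simp add: card_Diff_subset finite_subset a_def)
    finally show "L U * L (C - U) \<le> real a ^ 2 * (fact (r * card U) * fact (r * (a - card U)))"
      by (simp add: power2_eq_square mult_ac)
  qed
  also have "\<dots> = (\<Sum>U\<in>Pow C. if good (card U)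
      then real a ^ 2 * (fact (r * card U) * fact (r * (a - card U))) * y else 0)"
    unfolding Us_def using finC by (subst sum.inter_filter) auto
  also have "\<dots> = (\<Sum>s\<le>a. real (a choose s) * (if good s
      then real a ^ 2 * (fact (r * s) * fact (r * (a - s))) * y else 0))"
    unfolding a_def by (rule sum_card_Pow[OF finC])
  also have "\<dots> \<le> (\<Sum>s\<le>a. real a ^ 2 * (fact (r * a) / 2 ^ d) * y)"
  proof (rule sum_mono)
    fix s assume s: "s \<in> {..a}"
    show "real (a choose s) * (if good s then real a ^ 2 * (fact (r * s) * fact (r * (a - s))) * y else 0)
        \<le> real a ^ 2 * (fact (r * a) / 2 ^ d) * y"
    proof (cases "good s")
      case True
      have ds: "d \<le> s" "d \<le> a - s"
      proof -
        have "2 * (r + 1) * d \<le> 2 * (r + 1) * s" "2 * (r + 1) * d \<le> 2 * (r + 1) * (a - s)"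
          using True assms(5) unfolding good_def a_def[symmetric] by (meson le_trans)+
        then show "d \<le> s" "d \<le> a - s" by (simp_all only: mult_le_cancel1) simp_all
      qed
      have "real (a choose s) * (fact (r * s) * fact (r * (a - s))) \<le> fact (r * a) / real (a choose s)"
        using choose_fact_mult_le[OF assms(2), of s a] s by (simp add: mult.assoc)
      also have "\<dots> \<le> fact (r * a) / 2 ^ d"
        using two_power_le_choose[of s a d] ds s by (intro divide_left_mono) auto
      finally have "real a ^ 2 * (real (a choose s) * (fact (r * s) * fact (r * (a - s)))) * y
          \<le> real a ^ 2 * (fact (r * a) / 2 ^ d) * y"
        using y0 by (intro mult_right_mono mult_left_mono) auto
      then show ?thesis using True by (simp add: mult_ac)
    qed (use y0 in simp)
  qed
  also have "\<dots> = real a ^ 2 * real (a + 1) / 2 ^ d * (fact (r * a) * (exp z - 1) ^ a / (z * real n) ^ (r * a))"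
    by (simp add: y_def)
  finally show ?thesis by (simp add: a_def)
qed

lemma prob_splitting_le:
  assumes "n > 0" "r \<ge> 2"
  shows "measure_pmf.prob (random_dfa n r)
    {A. \<exists>C\<in>{C\<in>Pow {0..<n}. 0 < card C \<and> n \<le> 6 * card C}. splits r C A}
    \<le> real (n + 1) * (real n ^ 2 * real (n + 1) / 2 ^ (n div (12 * (r + 1))) * (exp 1 * real (r * n)))"
proof (rule prob_bex_set_le[where J = "\<lambda>a. n \<le> 6 * a"
    and w = "\<lambda>a. real a ^ 2 * real (a + 1) / 2 ^ (n div (12 * (r + 1)))"])
  \<comment> \<open>Chosen so that \<open>2 * (r + 1) * d \<le> n / 6 \<le> card C\<close>, as
    \<open>prob_splits_le\<close> demands.\<close>
  define d where "d = n div (12 * (r + 1))"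
  have d: "6 * (2 * (r + 1) * d) \<le> n"
  proof -
    have "6 * (2 * (r + 1) * d) = 12 * (r + 1) * d" by (simp add: algebra_simps)
    also have "\<dots> \<le> n" unfolding d_def by (rule times_div_less_eq_dividend)
    finally show ?thesis .
  qed
  fix C assume C: "C \<subseteq> {0..<n}" "0 < card C" "n \<le> 6 * card C"
  have "6 * (2 * (r + 1) * d) \<le> 6 * card C" using d C(3) by (rule le_trans)
  then have "2 * (r + 1) * d \<le> card C" by simp
  moreover have "real (r * card C) / real n > 0" using assms C by simp
  ultimately show "measure_pmf.prob (random_dfa n r) {A. splits r C A} \<le>
      real (card C) ^ 2 * real (card C + 1) / 2 ^ (n div (12 * (r + 1))) *
        (let z = real (r * card C) / real n in
         fact (r * card C) * (exp z - 1) ^ card C / (z * real n) ^ (r * card C))"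
    using prob_splits_le[OF assms C(1) _ _ C(2), of _ d] unfolding Let_def d_def by blast
next
  fix a assume a: "0 < a" "a \<le> n" "n \<le> 6 * a"
  have "occupancy n r a \<le> exp 1 * real (r * n) * pmf (binomial_pmf n (1 - exp (- (real r * (real a / real n))))) a"
    using a assms by (intro occupancy_le_binomial) auto
  \<comment> \<open>The trivial bound on the binomial probability suffices here, since the decay
    comes from \<open>2 ^ d\<close>.\<close>
  also have "\<dots> \<le> exp 1 * real (r * n) * 1"
    by (intro mult_left_mono pmf_le_1) auto
  finally have occ: "occupancy n r a \<le> exp 1 * real (r * n)" by simp
  have "real a ^ 2 * real (a + 1) / 2 ^ (n div (12 * (r + 1))) * occupancy n r a \<le>
      real a ^ 2 * real (a + 1) / 2 ^ (n div (12 * (r + 1))) * (exp 1 * real (r * n))"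
    by (intro mult_left_mono occ) auto
  also have "\<dots> \<le> real n ^ 2 * real (n + 1) / 2 ^ (n div (12 * (r + 1))) * (exp 1 * real (r * n))"
    using a by (intro mult_right_mono divide_right_mono mult_mono power_mono) auto
  finally show "real a ^ 2 * real (a + 1) / 2 ^ (n div (12 * (r + 1))) * occupancy n r a \<le>
      real n ^ 2 * real (n + 1) / 2 ^ (n div (12 * (r + 1))) * (exp 1 * real (r * n))" .
qed (use assms in auto)

subsection \<open>The fixed point equation\<close>

text \<open>The chord inequality for the convex function \<open>F\<close>, cleared of denominators
  so that it can be evaluated at the zeros of \<open>F\<close>.\<close>

lemma exp_line_convex:
  fixes q u v w :: real
  assumes "u \<le> v" "v \<le> w" "u < w"
  defines "F \<equiv> \<lambda>x. x - 1 + exp (- (q * x))"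
  shows "F v * (w - u) \<le> F u * (w - v) + F w * (v - u)"
proof -
  define t where "t = (v - u) / (w - u)"
  have t: "0 \<le> t" "t \<le> 1" using assms by (simp_all add: t_def)
  have tw: "t * (w - u) = v - u" using assms by (simp add: t_def)
  then have v: "v = (1 - t) * u + t * w" by (simp add: algebra_simps)
  have "- (q * v) = (1 - t) * (- (q * u)) + t * (- (q * w))" by (simp add: v algebra_simps)
  then have "exp (- (q * v)) \<le> (1 - t) * exp (- (q * u)) + t * exp (- (q * w))"
    using convex_onD[OF exp_convex t, of "- (q * u)" "- (q * w)"] by simp
  then have "F v \<le> (1 - t) * F u + t * F w" unfolding F_def by (subst (1) v) (simp add: algebra_simps)
  then have "F v * (w - u) \<le> ((1 - t) * F u + t * F w) * (w - u)"
    using assms by (intro mult_right_mono) auto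
  also have "\<dots> = F u * ((w - u) - t * (w - u)) + F w * (t * (w - u))" by (simp add: algebra_simps)
  finally show ?thesis by (simp add: tw)
qed

text \<open>By convexity, \<open>x - 1 + exp (- r x)\<close> lies below its chord over \<open>[1/6, c]\<close> and above the
  extension of that chord beyond \<open>c\<close>.\<close>
lemma fixed_point_separation:
  fixes c :: real
  assumes "r \<ge> 2" "c > 0" "c = 1 - exp (- c * real r)"
  shows "c > 1 / 2"
    and "\<exists>\<kappa>>0. \<forall>x\<ge>1 / 6. \<kappa> * \<bar>x - c\<bar> \<le> \<bar>x - (1 - exp (- (real r * x)))\<bar>"
proof -
  define F where "F x = x - 1 + exp (- (real r * x))" for x
  have conv: "F v * (w - u) \<le> F u * (w - v) + F w * (v - u)" if "u \<le> v" "v \<le> w" "u < w" for u v w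
    unfolding F_def by (rule exp_line_convex[OF that])
  have F0: "F 0 = 0" by (simp add: F_def)
  have Fc: "F c = 0" using assms(3) by (simp add: F_def mult.commute)
  have Fh: "F (1 / 2) < 0"
  proof -
    have "3 / 2 \<le> exp (1 / 2 :: real)" using exp_ge_add_one_self[of "1 / 2"] by simp
    then have "(3 / 2) * (3 / 2) \<le> exp (1 / 2) * exp (1 / 2 :: real)" by (intro mult_mono) auto
    then have "exp (1 :: real) > 2" by (simp add: exp_add[symmetric])
    then have "exp (- 1 :: real) < 1 / 2" by (simp add: exp_minus field_simps)
    moreover have "exp (- (real r * (1 / 2))) \<le> exp (- 1)" using assms(1) by simp
    ultimately have "exp (- (real r * (1 / 2))) < 1 / 2" by linarith
    then show ?thesis by (simp add: F_def)
  qed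
  \<comment> \<open>By convexity \<open>F\<close> is nonnegative to the right of its zeros 0 and
    \<open>c\<close>, whereas \<open>F (1 / 2) < 0\<close>.\<close>
  show ch: "c > 1 / 2"
  proof (rule ccontr)
    assume "\<not> c > 1 / 2"
    then have "0 \<le> F (1 / 2) * c" using conv[of 0 c "1 / 2"] assms(2) F0 Fc by simp
    then show False using Fh assms(2) by (simp add: zero_le_mult_iff)
  qed
  have F6: "F (1 / 6) < 0" using conv[of 0 "1 / 6" "1 / 2"] F0 Fh by simp
  \<comment> \<open>The slope of the chord of \<open>F\<close> over \<open>[1/6, c]\<close>,
    positive since \<open>F (1 / 6) < 0 = F c\<close>. The left end 1/6 matches the sizes left over
    by \<open>prob_small_closed_le\<close>.\<close>
  define \<kappa> where "\<kappa> = - F (1 / 6) / (c - 1 / 6)"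
  have "\<kappa> > 0" unfolding \<kappa>_def using F6 ch by (intro divide_pos_pos) auto
  moreover have "\<kappa> * \<bar>x - c\<bar> \<le> \<bar>x - (1 - exp (- (real r * x)))\<bar>" if x: "x \<ge> 1 / 6" for x
  proof -
    have pos: "c - 1 / 6 > 0" using ch by simp
    have "- F (1 / 6) * \<bar>x - c\<bar> \<le> \<bar>F x\<bar> * (c - 1 / 6)"
    proof (cases "x \<le> c")
      case True
      then have "F x * (c - 1 / 6) \<le> F (1 / 6) * (c - x)" using conv[of "1 / 6" x c] x ch Fc by simp
      moreover have "- F x * (c - 1 / 6) \<le> \<bar>F x\<bar> * (c - 1 / 6)"
        using pos by (intro mult_right_mono) auto
      moreover have "\<bar>x - c\<bar> = c - x" using True by simp
      ultimately show ?thesis by simp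
    next
      case False
      then have "0 \<le> F (1 / 6) * (x - c) + F x * (c - 1 / 6)" using conv[of "1 / 6" c x] ch Fc by simp
      moreover have "F x * (c - 1 / 6) \<le> \<bar>F x\<bar> * (c - 1 / 6)"
        using pos by (intro mult_right_mono) auto
      moreover have "\<bar>x - c\<bar> = x - c" using False by simp
      ultimately show ?thesis by simp
    qed
    moreover have "\<kappa> * \<bar>x - c\<bar> = - F (1 / 6) * \<bar>x - c\<bar> / (c - 1 / 6)" by (simp add: \<kappa>_def)
    ultimately have "\<kappa> * \<bar>x - c\<bar> \<le> \<bar>F x\<bar>" by (simp only: pos_divide_le_eq[OF pos])
    also have "F x = x - (1 - exp (- (real r * x)))" by (simp add: F_def)
    finally show ?thesis .
  qed
  ultimately show "\<exists>\<kappa>>0. \<forall>x\<ge>1 / 6. \<kappa> * \<bar>x - c\<bar> \<le> \<bar>x - (1 - exp (- (real r * x)))\<bar>" by blast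
qed

section \<open>Asymptotics of the error bounds\<close>

text \<open>For the deviation \<open>n powr (3/4)\<close> the exponent is a negative multiple of the
  square root of \<open>n\<close>, which beats the polynomial factor.\<close>

lemma atypical_size_bound_tendsto_0:
  assumes "K > 0"
  shows "(\<lambda>n. real (n + 1) * (exp 1 * real (r * n) * (2 * exp (- (2 * K\<^sup>2 * (real n powr (3/4))\<^sup>2 / real n))))) \<longlonglongrightarrow> 0"
  unfolding of_nat_mult using assms by real_asymp

text \<open>Rounding in \<open>n div N\<close> costs at most a factor 2, so that
  \<open>2 ^ (n div N)\<close> can be replaced by a real power of 2 with exponent
  \<open>n / N\<close>.\<close>

lemma splitting_bound_tendsto_0:
  "(\<lambda>n. real (n + 1) * (real n ^ 2 * real (n + 1) / 2 ^ (n div (12 * (r + 1))) * (exp 1 * real (r * n)))) \<longlonglongrightarrow> 0"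
proof -
  define N where "N = 12 * (r + 1)"
  have "(\<lambda>n. real (n + 1) * (real n ^ 2 * real (n + 1) * (2 * 2 powr (- (real n / real N))) * (exp 1 * real (r * n)))) \<longlonglongrightarrow> 0"
  proof -
    have "real N > 0" by (simp add: N_def)
    then show ?thesis unfolding of_nat_mult by real_asymp
  qed
  then show ?thesis
  proof (rule Lim_null_comparison[rotated])
    show "\<forall>\<^sub>F n in sequentially. norm (real (n + 1) * (real n ^ 2 * real (n + 1) / 2 ^ (n div (12 * (r + 1))) * (exp 1 * real (r * n))))
       \<le> real (n + 1) * (real n ^ 2 * real (n + 1) * (2 * 2 powr (- (real n / real N))) * (exp 1 * real (r * n)))"
    proof (rule always_eventually, rule allI)
      fix n
      have "real n / real N \<le> real (n div N) + 1"
      proof -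
        have "real n = real N * real (n div N) + real (n mod N)"
          by (metis mult_div_mod_eq of_nat_add of_nat_mult)
        moreover have "n mod N < N" by (simp add: N_def)
        ultimately have "real n \<le> real N * (real (n div N) + 1)" by (simp add: algebra_simps)
        then show ?thesis by (simp add: N_def field_simps)
      qed
      then have le: "2 powr (- (real (n div N) + 1)) \<le> 2 powr (- (real n / real N))"
        by (intro powr_mono) auto
      have "2 powr (- (real (n div N) + 1)) = 1 / (2 * 2 ^ (n div N))"
        by (simp only: powr_minus) (simp add: powr_add powr_realpow inverse_eq_divide)
      then have "1 / 2 ^ (n div N) = 2 * 2 powr (- (real (n div N) + 1))" by simp
      also have "\<dots> \<le> 2 * 2 powr (- (real n / real N))" using le by (rule mult_left_mono) simp
      finally have "1 / 2 ^ (n div N) \<le> 2 * 2 powr (- (real n / real N))" .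
      then have "real n ^ 2 * real (n + 1) * (1 / 2 ^ (n div N)) \<le> real n ^ 2 * real (n + 1) * (2 * 2 powr (- (real n / real N)))"
        by (intro mult_left_mono) auto
      then have "real (n + 1) * (real n ^ 2 * real (n + 1) * (1 / 2 ^ (n div N)) * (exp 1 * real (r * n))) \<le>
         real (n + 1) * (real n ^ 2 * real (n + 1) * (2 * 2 powr (- (real n / real N))) * (exp 1 * real (r * n)))"
        by (rule mult_left_mono[OF mult_right_mono]) auto
      then show "norm (real (n + 1) * (real n ^ 2 * real (n + 1) / 2 ^ (n div (12 * (r + 1))) * (exp 1 * real (r * n))))
       \<le> real (n + 1) * (real n ^ 2 * real (n + 1) * (2 * 2 powr (- (real n / real N))) * (exp 1 * real (r * n)))"
        by (simp add: N_def)
    qed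
  qed
qed

subsection \<open>The closed class of a random DFA\<close>

theorem theorem3:
  fixes r :: nat and c :: real
  assumes "r \<ge> 2"
    and "c > 0" and "c = 1 - exp (- c * real r)"
  shows "\<exists>g :: nat \<Rightarrow> real. g \<in> o(\<lambda>n. real n) \<and>
    ((\<lambda>n. measure_pmf.prob (random_dfa n r)
        {A. \<exists>C. closed_class n r A C \<and> (\<forall>C'. closed_class n r A C' \<longrightarrow> C' = C) \<and>
              aperiodic r A C \<and> \<bar>real (card C) - c * real n\<bar> \<le> g n})
      \<longlonglongrightarrow> 1)"
proof -
  \<comment> \<open>The exponent lies strictly between 1/2, the scale of binomial fluctuations, and
    1, so that \<open>g\<close> is \<open>o(n)\<close>.\<close>
  define g where "g n = real n powr (3 / 4)" for n :: nat
  define good where "good n = {A. \<exists>C. closed_class n r A C \<and> (\<forall>C'. closed_class n r A C' \<longrightarrow> C' = C) \<and>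
              aperiodic r A C \<and> \<bar>real (card C) - c * real n\<bar> \<le> g n}" for n
  have c_half: "c > 1 / 2" by (rule fixed_point_separation(1)[OF assms])
  obtain \<kappa> where \<kappa>: "\<kappa> > 0"
    "\<And>x. x \<ge> 1 / 6 \<Longrightarrow> \<kappa> * \<bar>x - c\<bar> \<le> \<bar>x - (1 - exp (- (real r * x)))\<bar>"
    using fixed_point_separation(2)[OF assms] by blast
  define b1 where "b1 n = 12 / real n" for n
  define b2 where "b2 n = real (n + 1) * (exp 1 * real (r * n) * (2 * exp (- (2 * \<kappa>\<^sup>2 * (g n)\<^sup>2 / real n))))" for n
  define b3 where "b3 n = real (n + 1) * (real n ^ 2 * real (n + 1) / 2 ^ (n div (12 * (r + 1))) * (exp 1 * real (r * n)))" for n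
  \<comment> \<open>Outside three bad events the automaton is good: \<open>B1\<close> is a small
    closed set, \<open>B2\<close> a self-covering set of atypical size, \<open>B3\<close> a set with
    a balanced cyclic cut. The condition \<open>gn\<close> puts typical sizes above
    \<open>n / 2\<close>, so two disjoint closed classes cannot coexist; it holds eventually because
    \<open>c > 1 / 2\<close>.\<close>
  have lower: "1 - (b1 n + b2 n + b3 n) \<le> measure_pmf.prob (random_dfa n r) (good n)"
    if n: "n > 0" and gn: "real n / 2 < c * real n - g n" for n
  proof -
    define B1 where "B1 = {A. \<exists>C\<in>{C\<in>Pow {0..<n}. C \<noteq> {} \<and> 6 * card C \<le> n}. tau_1 r A C \<subseteq> C}"
    define B2 where "B2 = {A. \<exists>C\<in>{C\<in>Pow {0..<n}. 0 < card C \<and> n \<le> 6 * card C \<and> \<bar>real (card C) - c * real n\<bar> > g n}.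
        tau_1 r A C = C}"
    define B3 where "B3 = {A. \<exists>C\<in>{C\<in>Pow {0..<n}. 0 < card C \<and> n \<le> 6 * card C}. splits r C A}"
    let ?p = "measure_pmf.prob (random_dfa n r)"
    have "?p B1 \<le> b1 n" unfolding B1_def b1_def by (rule prob_small_closed_le[OF n assms(1)])
    moreover have "?p B2 \<le> b2 n" unfolding B2_def b2_def
      using n assms(1) \<kappa> by (intro prob_atypical_size_le) (auto simp: g_def)
    moreover have "?p B3 \<le> b3 n" unfolding B3_def b3_def by (rule prob_splitting_le[OF n assms(1)])
    moreover have "1 \<le> ?p (good n \<union> B1 \<union> B2 \<union> B3)"
    proof -
      have "dfa_space n r \<subseteq> good n \<union> B1 \<union> B2 \<union> B3"
      proof
        fix A assume A: "A \<in> dfa_space n r"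
        show "A \<in> good n \<union> B1 \<union> B2 \<union> B3"
        proof (cases "A \<in> B1 \<union> B2 \<union> B3")
          case False
          have size: "n \<le> 6 * card C" "\<bar>real (card C) - c * real n\<bar> \<le> g n" "0 < card C" "finite C"
            if C: "closed_class n r A C" for C
          proof -
            have sub: "C \<in> Pow {0..<n}" and ne: "C \<noteq> {}" and t1: "tau_1 r A C = C"
              using closed_class_subset[OF C] closed_class_nonempty[OF C] closed_class_tau_1[OF C] assms(1) by auto
            show fin: "finite C" using sub by (auto intro: finite_subset)
            then show pos: "0 < card C" using ne by (simp add: card_gt_0_iff)
            show large: "n \<le> 6 * card C"
            proof (rule ccontr)
              assume "\<not> n \<le> 6 * card C"
              then have "A \<in> B1" using sub ne t1 unfolding B1_def by auto
              then show False using False by simp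
            qed
            show "\<bar>real (card C) - c * real n\<bar> \<le> g n"
            proof (rule ccontr)
              assume "\<not> \<bar>real (card C) - c * real n\<bar> \<le> g n"
              then have "A \<in> B2" using sub pos large t1 unfolding B2_def by auto
              then show False using False by simp
            qed
          qed
          obtain C where C: "closed_class n r A C" using closed_class_exists[OF A n] by blast
          have "D = C" if D: "closed_class n r A D" for D
          proof (rule closed_class_disjoint[OF D C], rule notI)
            assume "D \<inter> C = {}"
            then have "card D + card C = card (D \<union> C)"
              using size(4)[OF C] size(4)[OF D] by (simp add: card_Un_disjoint)
            also have "\<dots> \<le> card {0..<n}"
              using closed_class_subset[OF C] closed_class_subset[OF D] by (intro card_mono) auto
            finally have "real (card D) + real (card C) \<le> real n" by simp
            then show False using size(2)[OF C] size(2)[OF D] gn by linarith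
          qed
          moreover have "aperiodic r A C"
          proof (rule ccontr)
            assume "\<not> aperiodic r A C"
            then obtain k where "periodic r A k C" by (auto simp: aperiodic_def)
            then have "splits r C A" unfolding splits_def
              using size(4)[OF C] closed_class_nonempty[OF C] closed_class_tau_1[OF C] assms(1)
              by (intro periodic_balanced_split) auto
            then have "A \<in> B3" using closed_class_subset[OF C] size[OF C] unfolding B3_def by auto
            then show False using False by simp
          qed
          ultimately have "A \<in> good n" using C size(2)[OF C] unfolding good_def by blast
          then show ?thesis by simp
        qed auto
      qed
      then have "?p (dfa_space n r) \<le> ?p (good n \<union> B1 \<union> B2 \<union> B3)"
        by (intro measure_pmf.finite_measure_mono) auto
      moreover have "?p (dfa_space n r) = 1"
        unfolding random_dfa_def
        using n by (subst measure_pmf_of_set)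
          (auto simp: dfa_space_nonempty finite_dfa_space card_dfa_space)
      ultimately show ?thesis by simp
    qed
    moreover have "?p (good n \<union> B1 \<union> B2 \<union> B3) \<le> ?p (good n) + ?p B1 + ?p B2 + ?p B3"
      using measure_Un_le[of "good n \<union> B1 \<union> B2" "measure_pmf (random_dfa n r)" B3]
        measure_Un_le[of "good n \<union> B1" "measure_pmf (random_dfa n r)" B2]
        measure_Un_le[of "good n" "measure_pmf (random_dfa n r)" B1] by simp
    ultimately show ?thesis by linarith
  qed
  have "(\<lambda>n. measure_pmf.prob (random_dfa n r) (good n)) \<longlonglongrightarrow> 1"
  proof (rule tendsto_sandwich)
    have "(\<lambda>n. 1 - (b1 n + b2 n + b3 n)) \<longlonglongrightarrow> 1 - (0 + 0 + 0)"
    proof (intro tendsto_intros)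
      show "b1 \<longlonglongrightarrow> 0" unfolding b1_def by real_asymp
      show "b2 \<longlonglongrightarrow> 0" unfolding b2_def g_def by (rule atypical_size_bound_tendsto_0[OF \<kappa>(1)])
      show "b3 \<longlonglongrightarrow> 0" unfolding b3_def by (rule splitting_bound_tendsto_0)
    qed
    then show "(\<lambda>n. 1 - (b1 n + b2 n + b3 n)) \<longlonglongrightarrow> 1" by simp
    have "\<forall>\<^sub>F n in sequentially. real n / 2 < c * real n - g n"
      unfolding g_def using c_half by real_asymp
    then show "\<forall>\<^sub>F n in sequentially. 1 - (b1 n + b2 n + b3 n) \<le> measure_pmf.prob (random_dfa n r) (good n)"
      using eventually_gt_at_top[of 0] by eventually_elim (rule lower)
  qed auto
  moreover have "g \<in> o(\<lambda>n. real n)" unfolding g_def by real_asymp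
  ultimately show ?thesis unfolding good_def by blast
qed

end
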